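(* Let $k$ be an algebraically closed field of characteristic $2$. If the indices $i_1,\dots,i_s,j_1,\dots,j_s\in\{1,\dots,m\}$ are all different, then the $SO(4)$-invariant $F^{(i_1,\dots,i_s|j_1,\dots,j_s)}\in R_{4\times m}^{SO(4)}$ is not expressible as a polynomial in $SO(4)$-invariants of lower degree.
   Context: $k$ is an algebraically closed field of characteristic $2$. $O(4)$ is the group of linear automorphisms of $k^4$ (coordinates $x_1,x_2,y_1,y_2$) preserving the quadratic form $q=x_1y_1+x_2y_2$; $SO(4)$ is the connected component of the identity in the algebraic group $O(4)$ (a subgroup of index $2$). $R_{4\times m}$ is the algebra of polynomials over $k$ in the coordinates $x_1^{(i)},x_2^{(i)},y_1^{(i)},y_2^{(i)}$ of $m$ indeterminate vectors $v^{(1)},\dots,v^{(m)}$ in $k^4$, with $O(4)$ acting diagonally; a superscript group denotes the subalgebra of invariants. Degree means total degree. To $v^{(i)}$ associate the $2\times2$ matrix $V^{(i)}=\begin{pmatrix} x_1^{(i)} & x_2^{(i)}\\ y_2^{(i)} & y_1^{(i)}\end{pmatrix}$, so that $\det V^{(i)}=q(v^{(i)})$. For pairwise different indices $i_1,\dots,i_s,j_1,\dots,j_s$, consider the determinant of the $2s\times 2s$ matrix made of $s\times s$ blocks of size $2\times 2$, $$\left|\begin{matrix} V^{(i_1)} & V^{(j_1)} & & & \\ & V^{(i_2)} & V^{(j_2)} & & \\ & & \ddots & \ddots & \\ & & & V^{(i_{s-1})} & V^{(j_{s-1})}\\ V^{(j_s)} & & & & V^{(i_s)}\end{matrix}\right|,$$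 that is, block row $t$ has $V^{(i_t)}$ in block column $t$ and $V^{(j_t)}$ in block column $t+1$ (block columns read cyclically modulo $s$), and zeros elsewhere. This determinant is $SO(4)$-invariant. $F^{(i_1,\dots,i_s|j_1,\dots,j_s)}$ denotes its $2s$-linear component, i.e. its multi-homogeneous component of degree $1$ in each of the $2s$ vectors $v^{(i_1)},\dots,v^{(i_s)},v^{(j_1)},\dots,v^{(j_s)}$; it is also $SO(4)$-invariant. *)

theory Defs
  imports
    "HOL-Analysis.Analysis"
    "HOL-Library.Poly_Mapping"
    "HOL-Computational_Algebra.Polynomial"
    "Jordan_Normal_Form.Determinant"
begin

text \<open>\<open>$\<close> is the component of a vector of type \<open>'k ^ 4\<close>; matrices of type \<open>mat\<close> occur only for the
  determinant whose size depends on \<open>s\<close>.\<close>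

no_notation Matrix.vec_index (infixl \<open>$\<close> 100)

section \<open>Multivariate polynomials\<close>

text \<open>Polynomials over \<open>'k\<close> in variables of type \<open>'v\<close>: monomials are finitely supported
  exponent functions, polynomials are finitely supported coefficient functions on monomials.\<close>

type_synonym ('v, 'k) mpoly = "('v \<Rightarrow>\<^sub>0 nat) \<Rightarrow>\<^sub>0 'k"

definition Const :: "'k::comm_ring_1 \<Rightarrow> ('v, 'k) mpoly" where
  "Const c = Poly_Mapping.single 0 c"

definition Var :: "'v \<Rightarrow> ('v, 'k::comm_ring_1) mpoly" where
  "Var v = Poly_Mapping.single (Poly_Mapping.single v 1) 1"

definition monom_degree :: "('v \<Rightarrow>\<^sub>0 nat) \<Rightarrow> nat" where
  "monom_degree \<mu> = (\<Sum>v\<in>Poly_Mapping.keys \<mu>. Poly_Mapping.lookup \<mu> v)"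

text \<open>Total degree; the zero polynomial gets degree \<open>0\<close>.\<close>

definition total_degree :: "('v, 'k::comm_ring_1) mpoly \<Rightarrow> nat" where
  "total_degree p = Max (insert 0 (monom_degree ` Poly_Mapping.keys p))"

definition indets :: "('v, 'k::comm_ring_1) mpoly \<Rightarrow> 'v set" where
  "indets p = (\<Union>\<mu>\<in>Poly_Mapping.keys p. Poly_Mapping.keys \<mu>)"

text \<open>Evaluation at \<open>f\<close>, the coefficients being transported by \<open>\<kappa>\<close>.\<close>

definition insertion ::
  "('k::comm_ring_1 \<Rightarrow> 'r::comm_ring_1) \<Rightarrow> ('v \<Rightarrow> 'r) \<Rightarrow> ('v, 'k) mpoly \<Rightarrow> 'r" where
  "insertion \<kappa> f p =
     (\<Sum>\<mu>\<in>Poly_Mapping.keys p. \<kappa> (Poly_Mapping.lookup p \<mu>) *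
        (\<Prod>v\<in>Poly_Mapping.keys \<mu>. f v ^ Poly_Mapping.lookup \<mu> v))"

definition eval_at :: "('v \<Rightarrow> 'k::comm_ring_1) \<Rightarrow> ('v, 'k) mpoly \<Rightarrow> 'k" where
  "eval_at = insertion (\<lambda>c. c)"

definition poly_subst ::
  "('v \<Rightarrow> ('w, 'k::comm_ring_1) mpoly) \<Rightarrow> ('v, 'k) mpoly \<Rightarrow> ('w, 'k) mpoly" where
  "poly_subst = insertion Const"


section \<open>The groups \<open>O(4)\<close> and \<open>SO(4)\<close>\<close>

text \<open>The coordinates \<open>x\<^sub>1, x\<^sub>2, y\<^sub>1, y\<^sub>2\<close> on \<open>k\<^sup>4\<close> are the components \<open>1, 2, 3, 4\<close>, in this order.\<close>

definition qform :: "'k::field ^ 4 \<Rightarrow> 'k" where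
  "qform v = v $ 1 * v $ 3 + v $ 2 * v $ 4"

definition O4 :: "('k::field ^ 4 ^ 4) set" where
  "O4 = {A. invertible A \<and> (\<forall>v. qform (A *v v) = qform v)}"

text \<open>The Zariski topology on the affine space of \<open>4 \<times> 4\<close> matrices, generated by the principal
  open sets \<open>{A. p(A) \<noteq> 0}\<close>, which form a basis of it.\<close>

definition zariski :: "('k::field ^ 4 ^ 4) topology" where
  "zariski = topology_generated_by
     {{A. eval_at (\<lambda>(r, c). A $ r $ c) p \<noteq> 0} |p :: (4 \<times> 4, 'k) mpoly. True}"

definition SO4 :: "('k::field ^ 4 ^ 4) set" where
  "SO4 = connected_component_of_set (subtopology zariski O4) (Finite_Cartesian_Product.mat 1)"


section \<open>Invariants of several vectors\<close>

text \<open>The \<open>m\<close> vectors are indexed by a finite type \<open>'m\<close> with \<open>CARD('m) = m\<close>, so that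
  the algebra of polynomials in their coordinates is the whole type \<open>('m \<times> 4, 'k) mpoly\<close>;
  the variable \<open>(i, c)\<close> is the \<open>c\<close>-th coordinate of the \<open>i\<close>-th vector. Below, \<open>lin_act A f\<close>
  is the function \<open>v \<mapsto> f (\<lambda>i. A *v v i)\<close>; for invariants under a group it does not matter
  whether \<open>A\<close> or its inverse is substituted.\<close>

definition lin_act :: "'k::field ^ 4 ^ 4 \<Rightarrow> ('m \<times> 4, 'k) mpoly \<Rightarrow> ('m \<times> 4, 'k) mpoly" where
  "lin_act A = poly_subst (\<lambda>(i, c). \<Sum>d\<in>UNIV. Const (A $ c $ d) * Var (i, d))"

definition invariants :: "('k::field ^ 4 ^ 4) set \<Rightarrow> ('m \<times> 4, 'k) mpoly set" where
  "invariants G = {f. \<forall>A\<in>G. lin_act A f = f}"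

definition polynomial_in :: "('v, 'k::comm_ring_1) mpoly set \<Rightarrow> ('v, 'k) mpoly \<Rightarrow> bool" where
  "polynomial_in S f \<longleftrightarrow>
     (\<exists>(n::nat) g (P :: (nat, 'k) mpoly).
        (\<forall>l<n. g l \<in> S) \<and> indets P \<subseteq> {..<n} \<and> f = poly_subst g P)"


section \<open>The invariants \<open>F\<close>\<close>

definition V_mat :: "'m \<Rightarrow> ('m \<times> 4, 'k::field) mpoly mat" where
  "V_mat i = mat_of_rows_list 2
     [[Var (i, 1), Var (i, 2)],
      [Var (i, 4), Var (i, 3)]]"

text \<open>Rows and columns are numbered from \<open>0\<close>; entry \<open>(r, c)\<close> lies in the block
  \<open>(r div 2, c div 2)\<close>. For \<open>s = 1\<close> the only block is the sum of the two \<open>V\<close>-matrices, as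
  the block columns are read cyclically.\<close>

definition cyclic_block_mat :: "'m list \<Rightarrow> 'm list \<Rightarrow> ('m \<times> 4, 'k::field) mpoly mat" where
  "cyclic_block_mat I J = (let s = length I in
     Matrix.mat (2 * s) (2 * s) (\<lambda>(r, c).
       let t = r div 2; u = c div 2 in
         (if u = t then V_mat (I ! t) $$ (r mod 2, c mod 2) else 0) +
         (if u = (t + 1) mod s then V_mat (J ! t) $$ (r mod 2, c mod 2) else 0)))"

definition multidegree :: "('m \<times> 4 \<Rightarrow>\<^sub>0 nat) \<Rightarrow> 'm \<Rightarrow> nat" where
  "multidegree \<mu> i = (\<Sum>c\<in>UNIV. Poly_Mapping.lookup \<mu> (i, c))"

definition multihom_component ::
  "('m \<Rightarrow> nat) \<Rightarrow> ('m \<times> 4, 'k::field) mpoly \<Rightarrow> ('m \<times> 4, 'k) mpoly" where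
  "multihom_component \<delta> f =
     (\<Sum>\<mu> | \<mu> \<in> Poly_Mapping.keys f \<and> multidegree \<mu> = \<delta>.
        Poly_Mapping.single \<mu> (Poly_Mapping.lookup f \<mu>))"

definition F_inv :: "'m list \<Rightarrow> 'm list \<Rightarrow> ('m \<times> 4, 'k::field) mpoly" where
  "F_inv I J = multihom_component (\<lambda>i. if i \<in> set I \<union> set J then 1 else 0)
     (Determinant.det (cyclic_block_mat I J))"

end

theory Submission
  imports Defs
begin

text \<open>A vector of \<open>k\<^sup>4\<close> is a \<open>2 \<times> 2\<close> matrix \<open>V\<close> with \<open>q = det V\<close>.

\<^bold>\<open>Invariance.\<close> Every element of \<open>O(4)\<close> has the form \<open>V \<mapsto> gVh\<close> or \<open>V \<mapsto> gV\<^sup>Th\<close> with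
\<open>det g \<cdot> det h = 1\<close>: it sends the matrix units to matrices \<open>uw\<^sup>T\<close> of rank one, and two orthogonal
matrices of rank one share their column factor \<open>u\<close> or their row factor \<open>w\<close> (lemma
\<open>isotropic_frame\<close>). The Dickson polynomial is \<open>0\<close> on the first kind and \<open>1\<close> on the second, so the two
kinds are disjoint and relatively open, and the connected set \<open>SO(4)\<close> contains only elements of the first kind
(\<open>SO4_two_sided\<close>). Such a map multiplies the block matrix from both sides by block diagonal
matrices whose determinants have product \<open>1\<close>, hence fixes its determinant; and linear
substitutions respect multidegrees, so it fixes \<open>F\<close> as well.

\<^bold>\<open>Indecomposability.\<close> Let \<open>N\<close> be the set of the \<open>2s\<close> indices and mark \<open>p = i\<^sub>1\<close>. Restrict polynomials to
\<open>V\<^sup>i = t\<^sub>i\<close> times the identity for \<open>i \<noteq> p\<close>, and \<open>V\<^sup>p = diag(t\<^sub>p, 0)\<close>. This is a ring homomorphism into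
\<open>k[t\<^sub>i]\<close>; write \<open>t\<^sub>B\<close> for the product of the \<open>t\<^sub>i\<close> with \<open>i \<in> B\<close>. The exchange of \<open>x\<^sub>1, x\<^sub>2\<close> with \<open>y\<^sub>1, y\<^sub>2\<close> lies in
\<open>SO(4)\<close>, being joined to the identity by a polynomial curve (\<open>swap_in_SO4\<close>). For nonempty \<open>B\<close> with
\<open>p \<notin> B\<close> it permutes without fixed points the monomials that restrict to \<open>t\<^sub>B\<close>, so in an invariant
these occur in pairs with equal coefficients, and the coefficient of \<open>t\<^sub>B\<close> in the restriction
vanishes in characteristic \<open>2\<close> (\<open>scalar_restriction_swap_invariant\<close>). When two polynomials in \<open>k[t\<^sub>i]\<close>
with this property are multiplied, every way of splitting \<open>t\<^sub>N\<close> as \<open>t\<^sub>C t\<^bsub>N-C\<^esub>\<close> with both factors nontrivial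
contributes \<open>0\<close>, because \<open>p\<close> is missing from \<open>C\<close> or from \<open>N - C\<close>. So taking the coefficient of \<open>t\<^sub>N\<close> is a
derivation at the origin on invariants. It vanishes on invariants of degree below \<open>2s\<close>, hence on
every polynomial in them (\<open>top_free_mult\<close>). On \<open>F\<close> it takes the value \<open>1\<close>: the restricted block matrix
decouples into two cyclic bidiagonal matrices, with determinants \<open>\<Prod>t\<^bsub>i(r)\<^esub> + \<Prod>t\<^bsub>j(r)\<^esub>\<close> and \<open>\<Prod>t\<^bsub>j(r)\<^esub>\<close>
(\<open>scalar_restriction_det\<close>).\<close>

section \<open>Substitution in polynomials\<close>

lemma char2_add_self:
  fixes x :: "'a::ring_1" assumes "CHAR('a) = 2" shows "x + x = 0"
  by (metis assms mult_2 mult_zero_left of_nat_CHAR of_nat_numeral)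

lemma char2_minus:
  fixes x :: "'a::ring_1" assumes "CHAR('a) = 2" shows "- x = x" "y - x = y + x"
proof -
  show "- x = x" using char2_add_self[OF assms, of x] by (metis add_eq_0_iff)
  then show "y - x = y + x" by (metis diff_conv_add_uminus)
qed

text \<open>Polynomials are generated additively by terms, and monomials by powers of single variables; this one
rule serves both levels of the representation.\<close>
lemma poly_mapping_induct [case_names single add]:
  fixes p :: "'a \<Rightarrow>\<^sub>0 'b::comm_monoid_add"
  assumes single: "\<And>k c. P (Poly_Mapping.single k c)"
    and add: "\<And>p q. P p \<Longrightarrow> P q \<Longrightarrow> P (p + q)"
  shows "P p"
proof -
  have "P (\<Sum>k\<in>X. Poly_Mapping.single k (Poly_Mapping.lookup p k))" if "finite X" for X
    using that single[of undefined 0] by induction (auto intro: assms)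
  moreover have "p = (\<Sum>k\<in>Poly_Mapping.keys p. Poly_Mapping.single k (Poly_Mapping.lookup p k))"
    by (rule poly_mapping_eqI) (auto simp: lookup_sum lookup_single when_def in_keys_iff sum.delta)
  ultimately show ?thesis by (metis finite_keys)
qed

definition monom_eval :: "('v \<Rightarrow> 'r::comm_ring_1) \<Rightarrow> ('v \<Rightarrow>\<^sub>0 nat) \<Rightarrow> 'r" where
  "monom_eval f \<mu> = (\<Prod>v\<in>Poly_Mapping.keys \<mu>. f v ^ Poly_Mapping.lookup \<mu> v)"

lemma monom_eval_superset:
  assumes "finite X" "Poly_Mapping.keys \<mu> \<subseteq> X"
  shows "monom_eval f \<mu> = (\<Prod>v\<in>X. f v ^ Poly_Mapping.lookup \<mu> v)"
  unfolding monom_eval_def by (rule prod.mono_neutral_left) (use assms in \<open>auto simp: in_keys_iff\<close>)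

lemma monom_eval_zero [simp]: "monom_eval f 0 = 1"
  by (simp add: monom_eval_def)

lemma monom_eval_single [simp]: "monom_eval f (Poly_Mapping.single v n) = f v ^ n"
  by (simp add: monom_eval_def)

lemma monom_eval_add: "monom_eval f (\<mu> + \<nu>) = monom_eval f \<mu> * monom_eval f \<nu>"
proof -
  let ?X = "Poly_Mapping.keys \<mu> \<union> Poly_Mapping.keys \<nu>"
  have "monom_eval f (\<mu> + \<nu>) = (\<Prod>v\<in>?X. f v ^ Poly_Mapping.lookup (\<mu> + \<nu>) v)"
    by (rule monom_eval_superset) (use keys_add[of \<mu> \<nu>] in auto)
  also have "\<dots> = monom_eval f \<mu> * monom_eval f \<nu>"
    by (simp add: monom_eval_superset[of ?X] lookup_add power_add prod.distrib)
  finally show ?thesis .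
qed

lemma insertion_superset:
  assumes "finite X" "Poly_Mapping.keys p \<subseteq> X" "\<kappa> 0 = 0"
  shows "insertion \<kappa> f p = (\<Sum>\<mu>\<in>X. \<kappa> (Poly_Mapping.lookup p \<mu>) * monom_eval f \<mu>)"
  unfolding insertion_def monom_eval_def
  by (rule sum.mono_neutral_left) (use assms in \<open>auto simp: in_keys_iff\<close>)

context
  fixes \<kappa> :: "'k::comm_ring_1 \<Rightarrow> 'r::comm_ring_1"
  assumes hom: "comm_ring_hom \<kappa>"
begin

interpretation comm_ring_hom \<kappa> by (rule hom)

lemma insertion_monomial: "insertion \<kappa> f (Poly_Mapping.single \<mu> c) = \<kappa> c * monom_eval f \<mu>"
  by (subst insertion_superset[of "{\<mu>}"]) auto

lemma insertion_add: "insertion \<kappa> f (p + q) = insertion \<kappa> f p + insertion \<kappa> f q"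
proof -
  let ?X = "Poly_Mapping.keys p \<union> Poly_Mapping.keys q"
  have "insertion \<kappa> f (p + q) = (\<Sum>\<mu>\<in>?X. \<kappa> (Poly_Mapping.lookup (p + q) \<mu>) * monom_eval f \<mu>)"
    by (rule insertion_superset) (use keys_add[of p q] in auto)
  also have "\<dots> = insertion \<kappa> f p + insertion \<kappa> f q"
    by (simp add: insertion_superset[of ?X] lookup_add hom_add distrib_right sum.distrib)
  finally show ?thesis .
qed

lemma insertion_mult: "insertion \<kappa> f (p * q) = insertion \<kappa> f p * insertion \<kappa> f q"
proof (induction p rule: poly_mapping_induct)
  case (single \<mu> c)
  show ?case
  proof (induction q rule: poly_mapping_induct)
    case (single \<nu> d)
    show ?case by (simp add: mult_single insertion_monomial hom_mult monom_eval_add mult_ac)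
  qed (simp add: insertion_add distrib_left)
qed (simp add: insertion_add distrib_right)

lemma comm_ring_hom_insertion: "comm_ring_hom (insertion \<kappa> f)"
  by unfold_locales
     (simp_all add: insertion_add insertion_mult insertion_monomial hom_one
       single_one[symmetric] insertion_def[of _ _ 0] del: single_one)

lemma insertion_Var: "insertion \<kappa> f (Var v) = f v"
  by (simp add: Var_def insertion_monomial)

lemma insertion_Const: "insertion \<kappa> f (Const c) = \<kappa> c"
  by (simp add: Const_def insertion_monomial)

end

lemma comm_ring_hom_Const: "comm_ring_hom Const"
  by unfold_locales (simp_all add: Const_def single_add mult_single)

lemmas poly_subst_hom = comm_ring_hom_insertion[OF comm_ring_hom_Const, folded poly_subst_def]
lemmas poly_subst_Var = insertion_Var[OF comm_ring_hom_Const, folded poly_subst_def]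
lemmas poly_subst_Const = insertion_Const[OF comm_ring_hom_Const, folded poly_subst_def]
lemmas poly_subst_monomial = insertion_monomial[OF comm_ring_hom_Const, folded poly_subst_def]

lemma comm_ring_hom_id: "comm_ring_hom (\<lambda>c. c)"
  by unfold_locales auto

lemmas eval_at_hom = comm_ring_hom_insertion[OF comm_ring_hom_id, folded eval_at_def]
lemmas eval_at_Var = insertion_Var[OF comm_ring_hom_id, folded eval_at_def]

lemma hom_monom_eval:
  assumes "comm_ring_hom h" shows "h (monom_eval f \<mu>) = monom_eval (\<lambda>v. h (f v)) \<mu>"
proof -
  interpret comm_ring_hom h by (rule assms)
  show ?thesis by (simp add: monom_eval_def hom_prod hom_power)
qed

lemma lookup_Const_mult:
  "Poly_Mapping.lookup (Const c * p) \<mu> = c * Poly_Mapping.lookup p \<mu>"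
  unfolding Const_def mult_map_scale_conv_mult[symmetric]
  by transfer (simp add: when_def)

section \<open>The two kinds of orthogonal maps\<close>
definition mrow :: "4 \<Rightarrow> nat" where "mrow c = (if c = 1 \<or> c = 2 then 0 else 1)"
definition mcol :: "4 \<Rightarrow> nat" where "mcol c = (if c = 1 \<or> c = 4 then 0 else 1)"

lemma mrow_mcol_simps [simp]:
  "mrow 1 = 0" "mrow 2 = 0" "mrow 3 = 1" "mrow 4 = 1"
  "mcol 1 = 0" "mcol 2 = 1" "mcol 3 = 1" "mcol 4 = 0"
  by (simp_all add: mrow_def mcol_def)

text \<open>The map \<open>V \<mapsto> gVh\<close>. The matrix entry that holds the coordinate \<open>c\<close> is in row \<open>mrow c\<close> and column
\<open>mcol c\<close>. The factors are functions on \<open>{0, 1}\<close>, the index set of the blocks of \<open>cyclic_block_mat\<close>.\<close>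
definition two_sided :: "(nat \<Rightarrow> nat \<Rightarrow> 'k::field) \<Rightarrow> (nat \<Rightarrow> nat \<Rightarrow> 'k) \<Rightarrow> 'k ^ 4 ^ 4" where
  "two_sided g h = (\<chi> c d. g (mrow c) (mrow d) * h (mcol d) (mcol c))"

definition det2 :: "(nat \<Rightarrow> nat \<Rightarrow> 'k::comm_ring_1) \<Rightarrow> 'k" where
  "det2 g = g 0 0 * g 1 1 - g 0 1 * g 1 0"

definition polar :: "'k::field ^ 4 \<Rightarrow> 'k ^ 4 \<Rightarrow> 'k" where
  "polar v w = v $ 1 * w $ 3 + v $ 3 * w $ 1 + v $ 2 * w $ 4 + v $ 4 * w $ 2"

lemma qform_add: "qform (v + w) = qform v + qform w + polar v w"
  by (simp add: qform_def polar_def algebra_simps)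

text \<open>The matrix \<open>uw\<^sup>T\<close>.\<close>
definition rank_one :: "(nat \<Rightarrow> 'k::field) \<Rightarrow> (nat \<Rightarrow> 'k) \<Rightarrow> 'k ^ 4" where
  "rank_one u w = (\<chi> c. u (mrow c) * w (mcol c))"

definition area :: "(nat \<Rightarrow> 'k::comm_ring_1) \<Rightarrow> (nat \<Rightarrow> 'k) \<Rightarrow> 'k" where
  "area u w = u 0 * w 1 - u 1 * w 0"

text \<open>The Dickson invariant with respect to the symplectic basis formed by the coordinate vectors: the sum
of the products of corresponding entries of the two off-diagonal \<open>2 \<times> 2\<close> blocks.\<close>
definition dickson :: "'k::field ^ 4 ^ 4 \<Rightarrow> 'k" where
  "dickson A = A $ 1 $ 3 * A $ 3 $ 1 + A $ 1 $ 4 * A $ 3 $ 2 + A $ 2 $ 3 * A $ 4 $ 1 + A $ 2 $ 4 * A $ 4 $ 2"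

lemma vec4_eqI:
  fixes v w :: "'a ^ 4"
  assumes "v $ 1 = w $ 1" "v $ 2 = w $ 2" "v $ 3 = w $ 3" "v $ 4 = w $ 4"
  shows "v = w"
  using assms by (simp add: Finite_Cartesian_Product.vec_eq_iff forall_4)

lemma rank_one_if_qform_0:
  fixes v :: "'k::field ^ 4"
  assumes char: "CHAR('k) = 2" and "qform v = 0"
  obtains u w where "v = rank_one u w"
proof -
  have eq: "v $ 1 * v $ 3 = v $ 2 * v $ 4"
    using assms(2) char2_add_self[OF char, of "v $ 2 * v $ 4"] unfolding qform_def by (metis add_right_cancel)
  consider "v $ 1 \<noteq> 0" | "v $ 2 \<noteq> 0" | "v $ 1 = 0" "v $ 2 = 0" by blast
  then show thesis
  proof cases
    case 1
    have "v = rank_one (\<lambda>i. if i = 0 then 1 else v $ 4 / v $ 1) (\<lambda>i. if i = 0 then v $ 1 else v $ 2)"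
      using 1 eq by (intro vec4_eqI) (auto simp: rank_one_def field_simps)
    then show thesis by (rule that)
  next
    case 2
    have "v = rank_one (\<lambda>i. if i = 0 then 1 else v $ 3 / v $ 2) (\<lambda>i. if i = 0 then v $ 1 else v $ 2)"
      using 2 eq by (intro vec4_eqI) (auto simp: rank_one_def field_simps)
    then show thesis by (rule that)
  next
    case 3
    have "v = rank_one (\<lambda>i. if i = 0 then 0 else 1) (\<lambda>i. if i = 0 then v $ 4 else v $ 3)"
      using 3 by (intro vec4_eqI) (auto simp: rank_one_def)
    then show thesis by (rule that)
  qed
qed

lemma polar_rank_one:
  fixes u w :: "nat \<Rightarrow> 'k::field"
  assumes "CHAR('k) = 2"
  shows "polar (rank_one u w) (rank_one u' w') = area u u' * area w w'"
  by (simp add: polar_def rank_one_def area_def char2_minus[OF assms] algebra_simps)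

lemma polar_commute: "polar v w = polar w v"
  by (simp add: polar_def algebra_simps)

lemma area_0_parallel:
  fixes u :: "nat \<Rightarrow> 'k::field"
  assumes "area u u' = 0" "area u v \<noteq> 0"
  obtains c where "u' 0 = c * u 0" "u' 1 = c * u 1"
proof (cases "u 0 = 0")
  case True
  then show thesis using assms that[of "u' 1 / u 1"] by (auto simp: area_def)
next
  case False
  then show thesis using assms that[of "u' 0 / u 0"] by (auto simp: area_def field_simps)
qed

lemma rank_one_scale:
  assumes "u' 0 = c * u 0" "u' 1 = c * u 1"
  shows "rank_one u' w = rank_one u (\<lambda>i. c * w i)" "rank_one w u' = rank_one (\<lambda>i. c * w i) u"
  by (rule vec4_eqI; simp add: rank_one_def assms[unfolded One_nat_def])+

lemma area_scale: "area u (\<lambda>i. c * w i) = c * area u w" "area (\<lambda>i. c * u i) w = c * area u w"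
  by (simp_all add: area_def algebra_simps)

text \<open>The isotropic lines orthogonal to \<open>uw\<^sup>T\<close> form two families, the matrices with column factor \<open>u\<close> and those
with row factor \<open>w\<close>. Once \<open>b\<close> is in the first family, \<open>d\<close> must be in the second, because \<open>b\<close> and \<open>d\<close> are not
orthogonal; then \<open>c\<close>, orthogonal to both, has the remaining factors. The scalars are absorbed
into \<open>u'\<close> and \<open>w'\<close>, except for that of \<open>c\<close>, which \<open>polar a c = 1\<close> determines.\<close>
lemma isotropic_frame_first_ruling:
  fixes a b c d :: "'k::field ^ 4"
  assumes char: "CHAR('k) = 2"
    and q: "qform c = 0" "qform d = 0"
    and polar0: "polar a d = 0" "polar b c = 0" "polar d c = 0"
    and polar1: "polar a c = 1" "polar b d = 1"
    and a: "a = rank_one u w" and b: "b = rank_one ub wb" and par: "area u ub = 0"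
  shows "\<exists>u u' w w'. area u u' * area w w' = 1 \<and>
    a = rank_one u w \<and> b = rank_one u w' \<and> c = rank_one u' w' \<and> d = rank_one u' w"
proof -
  note pp = polar_rank_one[OF char]
  obtain uc wc where c: "c = rank_one uc wc" using rank_one_if_qform_0[OF char q(1)] .
  obtain ud wd where d: "d = rank_one ud wd" using rank_one_if_qform_0[OF char q(2)] .
  have ac: "area u uc \<noteq> 0" "area w wc \<noteq> 0" using polar1(1) by (auto simp: a c pp)
  obtain \<beta> where \<beta>: "ub 0 = \<beta> * u 0" "ub 1 = \<beta> * u 1" using area_0_parallel[OF par ac(1)] .
  define w' where "w' = (\<lambda>i. \<beta> * wb i)"
  have b': "b = rank_one u w'" unfolding b w'_def by (rule rank_one_scale(1)[of ub, OF \<beta>])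
  have "area w wd = 0" using polar0(1) polar1(2) by (auto simp: a b' d pp)
  then obtain \<delta> where \<delta>: "wd 0 = \<delta> * w 0" "wd 1 = \<delta> * w 1" using area_0_parallel[OF _ ac(2)] by blast
  define u' where "u' = (\<lambda>i. \<delta> * ud i)"
  have d': "d = rank_one u' w" unfolding d u'_def by (rule rank_one_scale(2)[of wd, OF \<delta>])
  have bd: "area u u' * area w' w = 1" using polar1(2) by (simp add: b' d' pp)
  have anti: "area x y = - area y x" for x y :: "nat \<Rightarrow> 'k" by (simp add: area_def)
  have "area w' wc = 0" using polar0(2) ac by (auto simp: b' c pp)
  moreover have "area w' w \<noteq> 0" using bd by auto
  ultimately obtain \<alpha> where \<alpha>: "wc 0 = \<alpha> * w' 0" "wc 1 = \<alpha> * w' 1" using area_0_parallel by blast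
  have "area u' uc = 0" using polar0(3) ac by (auto simp: d' c pp)
  moreover have "area u' u \<noteq> 0" using bd anti[of u u'] by auto
  ultimately obtain \<gamma> where \<gamma>: "uc 0 = \<gamma> * u' 0" "uc 1 = \<gamma> * u' 1" using area_0_parallel by blast
  have c': "c = rank_one u' (\<lambda>i. \<gamma> * (\<alpha> * w' i))"
    unfolding c
    by (rule vec4_eqI; simp add: rank_one_def \<gamma>[unfolded One_nat_def] \<alpha>[unfolded One_nat_def] mult_ac)
  have eq1: "area u u' * area w w' = 1" using bd anti[of w' w] char2_minus[OF char] by metis
  have "\<gamma> * \<alpha> * (area u u' * area w w') = 1"
    using polar1(1) by (simp add: a c' pp area_scale mult_ac)
  then have "\<gamma> * \<alpha> = 1" by (simp add: eq1)
  then have "c = rank_one u' w'" unfolding c' by (simp add: mult.assoc[symmetric])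
  then show ?thesis using eq1 a b' d' by blast
qed

text \<open>Exchanging \<open>b\<close> and \<open>d\<close> transposes the picture. If neither \<open>b\<close> nor \<open>d\<close> shared the column factor of \<open>a\<close>, both
would share its row factor and be orthogonal to each other.\<close>
lemma isotropic_frame:
  fixes a b c d :: "'k::field ^ 4"
  assumes char: "CHAR('k) = 2"
    and q: "qform a = 0" "qform b = 0" "qform c = 0" "qform d = 0"
    and polar0: "polar a b = 0" "polar a d = 0" "polar b c = 0" "polar d c = 0"
    and polar1: "polar a c = 1" "polar b d = 1"
  obtains u u' w w' where "area u u' * area w w' = 1"
    "a = rank_one u w" "b = rank_one u w'" "c = rank_one u' w'" "d = rank_one u' w"
  | u u' w w' where "area u u' * area w w' = 1"
    "a = rank_one u w" "d = rank_one u w'" "c = rank_one u' w'" "b = rank_one u' w"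
proof -
  note pp = polar_rank_one[OF char]
  obtain u w where a: "a = rank_one u w" using rank_one_if_qform_0[OF char q(1)] .
  obtain ub wb where b: "b = rank_one ub wb" using rank_one_if_qform_0[OF char q(2)] .
  obtain uc wc where c: "c = rank_one uc wc" using rank_one_if_qform_0[OF char q(3)] .
  obtain ud wd where d: "d = rank_one ud wd" using rank_one_if_qform_0[OF char q(4)] .
  have ac: "area u uc \<noteq> 0" "area w wc \<noteq> 0" using polar1(1) by (auto simp: a c pp)
  show thesis
  proof (cases "area u ub = 0")
    case True
    show thesis
      using isotropic_frame_first_ruling[OF char q(3,4) polar0(2,3,4) polar1 a b True] that(1) by blast
  next
    case False
    then have wb: "area w wb = 0" using polar0(1) by (auto simp: a b pp)
    have "area u ud = 0"
    proof (rule ccontr)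
      assume "area u ud \<noteq> 0"
      then have wd: "area w wd = 0" using polar0(2) by (auto simp: a d pp)
      obtain \<beta> where "wb 0 = \<beta> * w 0" "wb 1 = \<beta> * w 1" using area_0_parallel[OF wb ac(2)] .
      moreover obtain \<delta> where "wd 0 = \<delta> * w 0" "wd 1 = \<delta> * w 1" using area_0_parallel[OF wd ac(2)] by blast
      ultimately have "area wb wd = 0" by (simp add: area_def)
      then show False using polar1(2) by (simp add: b d pp)
    qed
    from isotropic_frame_first_ruling[OF char q(3,2) polar0(1,4,3) polar1(1) _ a d this] polar1(2) that(2)
    show thesis by (metis polar_commute)
  qed
qed

lemma O4_columns:
  fixes A :: "'k::field ^ 4 ^ 4"
  assumes "A \<in> O4"
  shows "qform (column i A) = 0" "i \<noteq> j \<Longrightarrow> polar (column i A) (column j A) = polar (axis i 1) (axis j 1)"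
proof -
  have pres: "qform (A *v v) = qform v" for v using assms by (simp add: O4_def)
  have col: "A *v axis i 1 = column i A" for i 
    by (simp add: Finite_Cartesian_Product.vec_eq_iff matrix_vector_mult_def column_def axis_def if_distrib cong: if_cong)
  have q0: "qform (axis i 1 :: 'k ^ 4) = 0" for i using exhaust_4[of i] by (auto simp: qform_def axis_def)
  show q1: "qform (column i A) = 0" for i using pres[of "axis i 1"] q0 by (simp add: col)
  have "qform (A *v (axis i 1 + axis j 1)) = qform (axis i 1 + axis j 1)" by (rule pres)
  then show "polar (column i A) (column j A) = polar (axis i 1) (axis j 1)"
    by (simp add: matrix_vector_right_distrib col qform_add q0 q1)
qed

text \<open>The four columns of an orthogonal matrix are isotropic and pair like the coordinate vectors, so they
form a frame of one of the two kinds. In the second kind the map is \<open>V \<mapsto> gV\<^sup>Th\<close>, for which the Dickson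
polynomial factors as \<open>det g \<cdot> det h\<close>.\<close>
lemma O4_cases:
  fixes A :: "'k::field ^ 4 ^ 4"
  assumes char: "CHAR('k) = 2" and A: "A \<in> O4"
  obtains g h where "A = two_sided g h" "det2 g * det2 h = 1"
  | "dickson A = 1"
proof -
  have entry: "A $ r $ c = column c A $ r" for r c by (simp add: column_def)
  have "polar (column 1 A) (column 2 A) = 0" "polar (column 1 A) (column 4 A) = 0"
    "polar (column 2 A) (column 3 A) = 0" "polar (column 4 A) (column 3 A) = 0"
    "polar (column 1 A) (column 3 A) = 1" "polar (column 2 A) (column 4 A) = 1"
    by (subst O4_columns(2)[OF A]; simp add: polar_def axis_def)+
  from isotropic_frame[OF char O4_columns(1)[OF A] O4_columns(1)[OF A] O4_columns(1)[OF A] O4_columns(1)[OF A] this]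
  show thesis
  proof cases
    case (1 u u' w w')
    define g where "g = (\<lambda>r c. if c = (0::nat) then u r else u' r)"
    define h where "h = (\<lambda>r c. if r = (0::nat) then w c else w' c)"
    have "A = two_sided g h"
      by (intro vec4_eqI) (simp_all add: entry 1 rank_one_def two_sided_def g_def h_def)
    moreover have "det2 g * det2 h = 1"
      using 1(1) by (simp add: det2_def area_def g_def h_def mult.commute)
    ultimately show thesis by (rule that(1))
  next
    case (2 u u' w w')
    have "dickson A = area u u' * area w w'"
      by (simp add: dickson_def entry 2 rank_one_def area_def char2_minus[OF char] algebra_simps)
    then show thesis using that(2) 2(1) by simp
  qed
qed

lemma dickson_two_sided:
  fixes g h :: "nat \<Rightarrow> nat \<Rightarrow> 'k::field"
  assumes "CHAR('k) = 2" shows "dickson (two_sided g h) = 0"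
proof -
  have "dickson (two_sided g h) = (g 0 1 * g 1 0 * (h 0 0 * h 1 1 + h 0 1 * h 1 0)) + (g 0 1 * g 1 0 * (h 0 0 * h 1 1 + h 0 1 * h 1 0))"
    by (simp add: dickson_def two_sided_def algebra_simps)
  then show ?thesis by (simp only: char2_add_self[OF assms])
qed

section \<open>The connected component of the identity\<close>
lemma infinite_alg_closed: "infinite (UNIV :: 'k::alg_closed_field set)"
proof
  assume fin: "finite (UNIV :: 'k set)"
  let ?q = "\<Prod>a\<in>UNIV. [:-a, 1:] :: 'k poly"
  have "degree ?q = card (UNIV :: 'k set)"
    by (subst degree_prod_sum_eq) auto
  then have "degree ?q > 0" using fin by (simp add: card_gt_0_iff)
  then have "degree (?q + 1) > 0" by (subst degree_add_eq_left) auto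
  then obtain x where "poly (?q + 1) x = 0" using alg_closed_imp_poly_has_root by blast
  moreover have "poly ?q x = 0" using fin by (auto simp: poly_prod prod_zero_iff)
  ultimately show False by simp
qed

lemma openin_zariski_basic:
  "openin zariski {A :: 'k::field ^ 4 ^ 4. eval_at (\<lambda>(r, c). A $ r $ c) p \<noteq> 0}"
  unfolding zariski_def by (rule topology_generated_by_Basis) blast

lemma topspace_zariski: "topspace (zariski :: ('k::field ^ 4 ^ 4) topology) = UNIV"
proof -
  interpret comm_ring_hom "eval_at f" for f :: "4 \<times> 4 \<Rightarrow> 'k" by (rule eval_at_hom)
  show ?thesis
    using openin_subset[OF openin_zariski_basic[of "1 :: (4 \<times> 4, 'k) mpoly"]] by (simp add: subset_antisym)
qed

lemma eval_at_polynomial_curve: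
  fixes p :: "('v, 'k::comm_ring_1) mpoly"
  shows "eval_at (\<lambda>v. poly (e v) t) p = poly (insertion (\<lambda>c. [:c:]) e p) t"
proof -
  have const: "comm_ring_hom (\<lambda>c::'k. [:c:])" by unfold_locales simp_all
  have ev: "comm_ring_hom (\<lambda>q::'k poly. poly q t)" by unfold_locales simp_all
  show ?thesis
  proof (induction p rule: poly_mapping_induct)
    case (single \<mu> c)
    show ?case
      by (simp add: eval_at_def insertion_monomial[OF const] insertion_monomial[OF comm_ring_hom_id] hom_monom_eval[OF ev])
  qed (simp add: eval_at_def insertion_add[OF const] insertion_add[OF comm_ring_hom_id])
qed

text \<open>A principal open set meets a polynomial curve in the complement of the zeros of a one-variable
polynomial, and the sets that are empty or cofinite are closed under the operations that
generate a topology.\<close>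
lemma polynomial_curve_cofinite:
  fixes \<gamma> :: "'k::field \<Rightarrow> 'k ^ 4 ^ 4"
  assumes curve: "\<And>t r c. \<gamma> t $ r $ c = poly (e (r, c)) t"
    and U: "openin zariski U"
  shows "(\<forall>t. \<gamma> t \<notin> U) \<or> finite {t. \<gamma> t \<notin> U}"
proof -
  have "generate_topology_on
     {{A. eval_at (\<lambda>(r, c). A $ r $ c) p \<noteq> 0} |p :: (4 \<times> 4, 'k) mpoly. True} U"
    using U unfolding zariski_def by (rule openin_topology_generated_by)
  then show ?thesis
  proof induction
    case (Int a b)
    have "{t. \<gamma> t \<notin> a \<inter> b} = {t. \<gamma> t \<notin> a} \<union> {t. \<gamma> t \<notin> b}" by auto
    with Int.IH show ?case by auto
  next
    case (UN K)
    show ?case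
    proof (cases "\<exists>k\<in>K. finite {t. \<gamma> t \<notin> k}")
      case True
      then obtain k where "k \<in> K" "finite {t. \<gamma> t \<notin> k}" by blast
      then have "finite {t. \<gamma> t \<notin> \<Union>K}" by (elim finite_subset[rotated]) auto
      then show ?thesis ..
    next
      case False
      then show ?thesis using UN.IH by blast
    qed
  next
    case (Basis s)
    then obtain p :: "(4 \<times> 4, 'k) mpoly"
      where s: "s = {A. eval_at (\<lambda>(r, c). A $ r $ c) p \<noteq> 0}" by blast
    define q where "q = insertion (\<lambda>c. [:c:]) e p"
    have "eval_at (\<lambda>(r, c). \<gamma> t $ r $ c) p = poly q t" for t
      unfolding q_def eval_at_polynomial_curve[symmetric]
      by (rule arg_cong[of _ _ "\<lambda>f. eval_at f p"]) (auto simp: curve)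
    then have *: "\<gamma> t \<notin> s \<longleftrightarrow> poly q t = 0" for t by (simp add: s)
    show ?case
    proof (cases "q = 0")
      case False
      then show ?thesis using poly_roots_finite[OF False] by (simp add: *)
    qed (simp add: *)
  qed simp
qed

text \<open>The parameter line is infinite, so two cofinite sets of parameters meet.\<close>
lemma connectedin_polynomial_curve:
  fixes \<gamma> :: "'k::alg_closed_field \<Rightarrow> 'k ^ 4 ^ 4"
  assumes "\<And>t r c. \<gamma> t $ r $ c = poly (e (r, c)) t"
  shows "connectedin zariski (range \<gamma>)"
  unfolding connectedin
proof (intro conjI notI, goal_cases)
  case 2
  then obtain U V where UV: "openin zariski U" "openin zariski V" "range \<gamma> \<subseteq> U \<union> V"
    "U \<inter> V \<inter> range \<gamma> = {}" "U \<inter> range \<gamma> \<noteq> {}" "V \<inter> range \<gamma> \<noteq> {}" by blast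
  have "finite {t. \<gamma> t \<notin> U}" "finite {t. \<gamma> t \<notin> V}"
    using polynomial_curve_cofinite[of \<gamma> e, OF assms UV(1)] polynomial_curve_cofinite[of \<gamma> e, OF assms UV(2)] UV(5,6) by auto
  moreover have "UNIV = {t. \<gamma> t \<notin> U} \<union> {t. \<gamma> t \<notin> V}" using UV(4) by auto
  ultimately show False using infinite_alg_closed[where ?'k = 'k] by (metis finite_UnI)
qed (simp add: topspace_zariski)

text \<open>On \<open>O(4)\<close> the Dickson polynomial takes only the values \<open>0\<close> and \<open>1\<close>, so the sets where it is nonzero, or
different from \<open>1\<close>, separate \<open>O(4)\<close>.\<close>
lemma SO4_two_sided:
  fixes A :: "'k::alg_closed_field ^ 4 ^ 4"
  assumes char: "CHAR('k) = 2" and A: "A \<in> SO4"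
  obtains g h where "A = two_sided g h" "det2 g * det2 h = 1"
proof -
  interpret ev: comm_ring_hom "eval_at f" for f :: "4 \<times> 4 \<Rightarrow> 'k" by (rule eval_at_hom)
  let ?v = "\<lambda>r c. Var (r, c) :: (4 \<times> 4, 'k) mpoly"
  define D where "D = ?v 1 3 * ?v 3 1 + ?v 1 4 * ?v 3 2 + ?v 2 3 * ?v 4 1 + ?v 2 4 * ?v 4 2"
  have D: "eval_at (\<lambda>(r, c). B $ r $ c) D = dickson B" for B :: "'k ^ 4 ^ 4"
    by (simp add: D_def ev.hom_add ev.hom_mult eval_at_Var dickson_def)
  \<comment> \<open>In characteristic 2, \<open>dickson B + 1 \<noteq> 0\<close> says that the value is not 1.\<close>
  define U where "U = {B :: 'k ^ 4 ^ 4. dickson B + 1 \<noteq> 0}"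
  define V where "V = {B :: 'k ^ 4 ^ 4. dickson B \<noteq> 0}"
  have "openin zariski U" "openin zariski V"
    using openin_zariski_basic[of "D + 1"] openin_zariski_basic[of D]
    by (simp_all add: U_def V_def D ev.hom_add)
  have conn: "connectedin zariski (SO4 :: ('k ^ 4 ^ 4) set)" and sub: "SO4 \<subseteq> (O4 :: ('k ^ 4 ^ 4) set)"
    using connectedin_connected_component_of[of "subtopology zariski O4" "Finite_Cartesian_Product.mat 1 :: 'k ^ 4 ^ 4"]
    unfolding SO4_def[symmetric] connectedin_subtopology by auto
  have cases: "dickson B = 0 \<or> dickson B = 1" if "B \<in> O4" for B :: "'k ^ 4 ^ 4"
    using O4_cases[OF char that] dickson_two_sided[OF char] by metis
  have 11: "(1::'k) + 1 = 0" by (rule char2_add_self[OF char])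
  have "SO4 \<subseteq> U \<union> V" by (auto simp: U_def V_def)
  moreover have "U \<inter> V \<inter> SO4 = {}" using cases sub 11 by (fastforce simp: U_def V_def)
  moreover have one: "Finite_Cartesian_Product.mat 1 \<in> (SO4 :: ('k ^ 4 ^ 4) set)"
    using A unfolding SO4_def
    by (metis connected_component_of_refl connected_component_of_equiv mem_Collect_eq)
  have "dickson (Finite_Cartesian_Product.mat 1 :: 'k ^ 4 ^ 4) = 0"
    by (simp add: dickson_def Finite_Cartesian_Product.mat_def)
  then have "Finite_Cartesian_Product.mat 1 \<in> U" by (simp add: U_def)
  then have "U \<inter> SO4 \<noteq> {}" using one by blast
  ultimately have "V \<inter> SO4 = {}"
    using connectedinD[OF conn \<open>openin zariski U\<close> \<open>openin zariski V\<close>] by blast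
  then have "dickson A = 0" using A by (auto simp: V_def)
  then show thesis using O4_cases[OF char subsetD[OF sub A]] that by (metis zero_neq_one)
qed

text \<open>The exchange \<open>x\<^sub>1 \<leftrightarrow> y\<^sub>1\<close>, \<open>x\<^sub>2 \<leftrightarrow> y\<^sub>2\<close>; on matrices, \<open>V \<mapsto> JVJ\<close> with \<open>J\<close> the \<open>2 \<times> 2\<close> exchange matrix.\<close>
definition swap4 :: "4 \<Rightarrow> 4" where
  "swap4 c = (if c = 1 then 3 else if c = 2 then 4 else if c = 3 then 1 else 2)"

lemma swap4_simps [simp]: "swap4 1 = 3" "swap4 2 = 4" "swap4 3 = 1" "swap4 4 = 2"
  by (simp_all add: swap4_def)

definition swap_mat :: "'k::field ^ 4 ^ 4" where
  "swap_mat = (\<chi> c d. if d = swap4 c then 1 else 0)"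

text \<open>In characteristic \<open>2\<close>, \<open>J\<close> is a product of elementary matrices with entry \<open>1\<close>: upper, lower, upper.
Replacing this entry by \<open>t\<close> gives a curve \<open>g(t)\<close> in \<open>SL\<^sub>2\<close> from the identity at \<open>t = 0\<close> to \<open>J\<close> at \<open>t = 1\<close>,
and \<open>V \<mapsto> g(t) V g(t)\<close> is the required curve in \<open>O(4)\<close>.\<close>
lemma swap_in_SO4:
  assumes char: "CHAR('k::alg_closed_field) = 2"
  shows "swap_mat \<in> (SO4 :: ('k ^ 4 ^ 4) set)"
proof -
  \<comment> \<open>The product of the three elementary matrices has both diagonal entries \<open>1 + t\<^sup>2\<close>, and \<open>t\<^sup>3\<close> and \<open>t\<close> off the diagonal.\<close>
  define g where "g = (\<lambda>r c. if r = c then [:1, 0, 1:] else if r = (0::nat) then [:0, 0, 0, 1:] else [:0, 1 :: 'k:])"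
  define e where "e = (\<lambda>(c, d). g (mrow c) (mrow d) * g (mcol d) (mcol c))"
  define \<gamma> where "\<gamma> t = two_sided (\<lambda>r c. poly (g r c) t) (\<lambda>r c. poly (g r c) t)" for t
  have curve: "\<gamma> t $ c $ d = poly (e (c, d)) t" for t c d
    by (simp add: \<gamma>_def two_sided_def e_def)
  have dbl: "x + x = 0" for x :: 'k by (rule char2_add_self[OF char])
  have dbl': "x + (x + y) = y" for x y :: 'k using dbl[of x] by (metis add.assoc add_0)
  have O: "\<gamma> t \<in> O4" for t
  proof -
    \<comment> \<open>\<open>g(t)\<close> has trace 0 and determinant 1, so it is its own inverse in characteristic 2.\<close>
    have "\<gamma> t ** \<gamma> t = Finite_Cartesian_Product.mat 1"
      by (intro vec4_eqI)
       (simp_all add: matrix_matrix_mult_def sum_4 \<gamma>_def two_sided_def g_def Finite_Cartesian_Product.mat_def algebra_simps dbl dbl')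
    then have "invertible (\<gamma> t)" unfolding invertible_def by blast
    moreover have "qform (\<gamma> t *v v) = qform v" for v
      by (simp add: qform_def matrix_vector_mult_def sum_4 \<gamma>_def two_sided_def g_def algebra_simps dbl dbl')
    ultimately show ?thesis by (simp add: O4_def)
  qed
  have "connectedin (subtopology zariski O4) (range \<gamma>)"
    using connectedin_polynomial_curve[of \<gamma> e, OF curve] O by (auto simp: connectedin_subtopology)
  moreover have "\<gamma> 0 = Finite_Cartesian_Product.mat 1"
    by (intro vec4_eqI) (simp_all add: \<gamma>_def two_sided_def g_def Finite_Cartesian_Product.mat_def)
  moreover have "\<gamma> 1 = swap_mat"
    by (intro vec4_eqI) (simp_all add: \<gamma>_def two_sided_def g_def dbl swap_mat_def)
  ultimately show ?thesis
    unfolding SO4_def connected_component_of_def mem_Collect_eq by (metis rangeI)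
qed

section \<open>Invariance of \<open>F\<close>\<close>
lemma lin_act_hom: "comm_ring_hom (lin_act A)"
  unfolding lin_act_def by (rule poly_subst_hom)

lemma lin_act_Var: "lin_act A (Var (i, c)) = (\<Sum>d\<in>UNIV. Const (A $ c $ d) * Var (i, d))"
  by (simp add: lin_act_def poly_subst_Var)

lemma less_2_cases: "(r::nat) < 2 \<Longrightarrow> r = 0 \<or> r = 1" by auto

lemma V_mat_entries [simp]:
  "V_mat i $$ (0, 0) = Var (i, 1)" "V_mat i $$ (0, Suc 0) = Var (i, 2)"
  "V_mat i $$ (Suc 0, 0) = Var (i, 4)" "V_mat i $$ (Suc 0, Suc 0) = Var (i, 3)"
  by (simp_all add: V_mat_def mat_of_rows_list_def)

lemma lin_act_V_mat:
  assumes "r < 2" "c < 2"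
  shows "lin_act (two_sided g h) (V_mat i $$ (r, c)) =
    (\<Sum>a<2. \<Sum>b<2. Const (g r a) * V_mat i $$ (a, b) * Const (h b c))"
proof -
  interpret comm_ring_hom "Const" by (rule comm_ring_hom_Const)
  show ?thesis
    using less_2_cases[OF assms(1)] less_2_cases[OF assms(2)]
    by (elim disjE; simp add: lin_act_Var sum_4 two_sided_def hom_mult numeral_2_eq_2 algebra_simps)
qed

definition block_diag :: "nat \<Rightarrow> (nat \<Rightarrow> nat \<Rightarrow> 'a::zero) \<Rightarrow> 'a mat" where
  "block_diag s g = Matrix.mat (2 * s) (2 * s)
     (\<lambda>(r, c). if r div 2 = c div 2 then g (r mod 2) (c mod 2) else 0)"

lemma block_diag_carrier [simp]: "block_diag s g \<in> carrier_mat (2 * s) (2 * s)"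
  by (simp add: block_diag_def)

lemma det_2x2: "Determinant.det (Matrix.mat 2 2 (\<lambda>(r, c). g r c)) = det2 g"
proof -
  have m: "mat_delete (Matrix.mat 2 2 (\<lambda>(r, c). g r c)) 0 j \<in> carrier_mat 1 1" for j
    by (auto simp: mat_delete_def)
  have "Determinant.det (Matrix.mat 2 2 (\<lambda>(r, c). g r c)) =
     (\<Sum>j<2. Matrix.mat 2 2 (\<lambda>(r, c). g r c) $$ (0, j) * cofactor (Matrix.mat 2 2 (\<lambda>(r, c). g r c)) 0 j)"
    by (rule laplace_expansion_row) auto
  also have "\<dots> = det2 g"
    unfolding cofactor_def det_single[OF m] by (simp add: numeral_2_eq_2 mat_delete_def det2_def)
  finally show ?thesis .
qed

text \<open>Stated over integral domains, as the determinant formula for block matrices requires; it is applied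
to constant matrices over the field and transported to the polynomial ring by \<open>Const\<close>.\<close>
lemma det_block_diag:
  fixes g :: "nat \<Rightarrow> nat \<Rightarrow> 'a::idom"
  shows "Determinant.det (block_diag s g) = det2 g ^ s"
proof (induction s)
  case 0
  show ?case by (simp add: block_diag_def)
next
  case (Suc s)
  let ?B = "Matrix.mat 2 2 (\<lambda>(r, c). g r c)"
  have "block_diag (Suc s) g = four_block_mat (block_diag s g) (0\<^sub>m (2 * s) 2) (0\<^sub>m 2 (2 * s)) ?B"
  proof (rule eq_matI, goal_cases)
    case (1 r c)
    have hi: "2 * s \<le> x \<Longrightarrow> x < 2 * s + 2 \<Longrightarrow> x div 2 = s \<and> x mod 2 = x - 2 * s" for x
    proof -
      assume "2 * s \<le> x" "x < 2 * s + 2"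
      then have "x = 2 * s \<or> x = 2 * s + 1" by auto
      then show ?thesis by auto
    qed
    have lo: "x div 2 \<noteq> s" "s \<noteq> x div 2" if "x < 2 * s" for x using that by auto
    have rc: "r < 2 * s + 2" "c < 2 * s + 2" using 1 by (simp_all add: block_diag_def)
    consider "r < 2 * s" "c < 2 * s" | "r < 2 * s" "2 * s \<le> c" | "2 * s \<le> r" "c < 2 * s"
      | "2 * s \<le> r" "2 * s \<le> c" by linarith
    then show ?case
    proof cases
      case 1
      then show ?thesis by (simp add: block_diag_def)
    next
      case 2
      then show ?thesis using rc hi[OF 2(2) rc(2)] lo[OF 2(1)] by (simp add: block_diag_def)
    next
      case 3
      then show ?thesis using rc hi[OF 3(1) rc(1)] lo[OF 3(2)] by (simp add: block_diag_def)
    next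
      case 4
      then show ?thesis using rc hi[OF 4(1) rc(1)] hi[OF 4(2) rc(2)] by (simp add: block_diag_def)
    qed
  qed (simp_all add: block_diag_def)
  then have "Determinant.det (block_diag (Suc s) g) = Determinant.det (block_diag s g) * Determinant.det ?B"
    by (simp only:) (rule det_four_block_mat_upper_right_zero, auto)
  then show ?case by (simp add: Suc.IH det_2x2 mult.commute)
qed

lemma sum_over_block:
  fixes f :: "nat \<Rightarrow> 'a::comm_monoid_add"
  assumes "t < s"
  shows "(\<Sum>r = 0..<2 * s. if r div 2 = t then f r else 0) = (\<Sum>a<2. f (2 * t + a))"
proof -
  have "(\<Sum>r = 0..<2 * s. if r div 2 = t then f r else 0) = sum f {r \<in> {0..<2 * s}. r div 2 = t}"
    by (rule sum.inter_filter[symmetric]) simp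
  also have "{r \<in> {0..<2 * s}. r div 2 = t} = {2 * t, 2 * t + 1}"
    using assms by auto
  finally show ?thesis by (simp add: numeral_2_eq_2)
qed

lemma block_diag_mult_left:
  fixes M :: "'a::comm_ring_1 mat"
  assumes "M \<in> carrier_mat (2 * s) (2 * s)" "r < 2 * s" "c < 2 * s"
  shows "(block_diag s g * M) $$ (r, c) = (\<Sum>a<2. g (r mod 2) a * M $$ (2 * (r div 2) + a, c))"
proof -
  have "(block_diag s g * M) $$ (r, c) =
    (\<Sum>x = 0..<2 * s. if x div 2 = r div 2 then g (r mod 2) (x mod 2) * M $$ (x, c) else 0)"
    using assms by (auto simp: scalar_prod_def block_diag_def intro!: sum.cong)
  also have "\<dots> = (\<Sum>a<2. g (r mod 2) a * M $$ (2 * (r div 2) + a, c))"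
    by (subst sum_over_block) (use assms(2) in \<open>auto intro!: sum.cong\<close>)
  finally show ?thesis .
qed

lemma block_diag_mult_right:
  fixes M :: "'a::comm_ring_1 mat"
  assumes "M \<in> carrier_mat (2 * s) (2 * s)" "r < 2 * s" "c < 2 * s"
  shows "(M * block_diag s h) $$ (r, c) = (\<Sum>b<2. M $$ (r, 2 * (c div 2) + b) * h b (c mod 2))"
proof -
  have "(M * block_diag s h) $$ (r, c) =
    (\<Sum>x = 0..<2 * s. if x div 2 = c div 2 then M $$ (r, x) * h (x mod 2) (c mod 2) else 0)"
    using assms by (auto simp: scalar_prod_def block_diag_def intro!: sum.cong)
  also have "\<dots> = (\<Sum>b<2. M $$ (r, 2 * (c div 2) + b) * h b (c mod 2))"
    by (subst sum_over_block) (use assms(3) in \<open>auto intro!: sum.cong\<close>)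
  finally show ?thesis .
qed

lemma cyclic_block_mat_carrier: "cyclic_block_mat I J \<in> carrier_mat (2 * length I) (2 * length I)"
  by (simp add: cyclic_block_mat_def Let_def)

lemma cyclic_block_mat_entry:
  assumes "t < length I" "u < length I" "a < 2" "b < 2"
  shows "cyclic_block_mat I J $$ (2 * t + a, 2 * u + b) =
    (if u = t then V_mat (I ! t) $$ (a, b) else 0) +
    (if u = (t + 1) mod length I then V_mat (J ! t) $$ (a, b) else 0)"
  using assms by (simp add: cyclic_block_mat_def Let_def)

text \<open>Every block is a sum of matrices \<open>V\<close>, each of which becomes \<open>gVh\<close>; so the left factor is the same in
all blocks, and so is the right factor.\<close>
lemma lin_act_cyclic_block_mat:
  "map_mat (lin_act (two_sided g h)) (cyclic_block_mat I J) =
    block_diag (length I) (\<lambda>a b. Const (g a b)) * cyclic_block_mat I J *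
    block_diag (length I) (\<lambda>a b. Const (h a b))"  (is "?L = ?G * ?M * ?H")
proof (rule eq_matI)
  let ?s = "length I"
  interpret comm_ring_hom "lin_act (two_sided g h)" by (rule lin_act_hom)
  note carr = cyclic_block_mat_carrier[of I J]
  fix r c assume "r < dim_row (?G * ?M * ?H)" "c < dim_col (?G * ?M * ?H)"
  then have rc: "r < 2 * ?s" "c < 2 * ?s" by (simp_all add: block_diag_def)
  let ?t = "r div 2" and ?u = "c div 2"
  have tu: "?t < ?s" "?u < ?s" using rc by auto
  have GM: "?G * ?M \<in> carrier_mat (2 * ?s) (2 * ?s)" by (intro mult_carrier_mat[OF _ carr]) simp
  have "(?G * ?M * ?H) $$ (r, c) =
     (\<Sum>b<2. (\<Sum>a<2. Const (g (r mod 2) a) * ?M $$ (2 * ?t + a, 2 * ?u + b)) * Const (h b (c mod 2)))"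
    using rc tu by (subst block_diag_mult_right[OF GM], simp, simp,
        intro sum.cong refl, subst block_diag_mult_left[OF carr]) auto
  also have "\<dots> = (\<Sum>a<2. \<Sum>b<2. Const (g (r mod 2) a) * ?M $$ (2 * ?t + a, 2 * ?u + b) * Const (h b (c mod 2)))"
    by (subst sum.swap) (simp add: sum_distrib_right)
  also have "\<dots> = (\<Sum>a<2. \<Sum>b<2. Const (g (r mod 2) a) * ((if ?u = ?t then V_mat (I ! ?t) $$ (a, b) else 0) +
    (if ?u = (?t + 1) mod ?s then V_mat (J ! ?t) $$ (a, b) else 0)) * Const (h b (c mod 2)))"
    by (intro sum.cong refl) (simp add: cyclic_block_mat_entry[OF tu])
  also have "\<dots> = (if ?u = ?t then lin_act (two_sided g h) (V_mat (I ! ?t) $$ (r mod 2, c mod 2)) else 0) +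
    (if ?u = (?t + 1) mod ?s then lin_act (two_sided g h) (V_mat (J ! ?t) $$ (r mod 2, c mod 2)) else 0)"
    by (simp add: lin_act_V_mat distrib_left distrib_right sum.distrib)
  also have "\<dots> = lin_act (two_sided g h) (?M $$ (2 * ?t + r mod 2, 2 * ?u + c mod 2))"
    by (subst cyclic_block_mat_entry[OF tu]) (simp_all add: hom_add)
  also have "\<dots> = ?L $$ (r, c)"
    using rc by (simp add: carrier_matD[OF carr])
  finally show "?L $$ (r, c) = (?G * ?M * ?H) $$ (r, c)" ..
qed (simp_all add: block_diag_def cyclic_block_mat_def Let_def)

lemma lin_act_det_cyclic_block_mat:
  fixes g h :: "nat \<Rightarrow> nat \<Rightarrow> 'k::field"
  assumes "det2 g * det2 h = 1"
  shows "lin_act (two_sided g h) (Determinant.det (cyclic_block_mat I J)) =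
    Determinant.det (cyclic_block_mat I J)"
proof -
  interpret L: comm_ring_hom "lin_act (two_sided g h)" by (rule lin_act_hom)
  interpret C: comm_ring_hom Const by (rule comm_ring_hom_Const)
  let ?s = "length I" and ?M = "cyclic_block_mat I J"
  have blk: "block_diag ?s (\<lambda>a b. Const (f a b)) = map_mat Const (block_diag ?s f)" for f
    by (rule eq_matI) (auto simp: block_diag_def)
  have det_blk: "Determinant.det (block_diag ?s (\<lambda>a b. Const (f a b))) = Const (det2 f ^ ?s)"
    for f :: "nat \<Rightarrow> nat \<Rightarrow> 'k"
    unfolding blk by (simp add: det_block_diag)
  let ?G = "block_diag ?s (\<lambda>a b. Const (g a b))" and ?H = "block_diag ?s (\<lambda>a b. Const (h a b))"
  note carr = cyclic_block_mat_carrier[of I J]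
  have GM: "?G * ?M \<in> carrier_mat (2 * ?s) (2 * ?s)" by (intro mult_carrier_mat[OF _ carr]) simp
  have "lin_act (two_sided g h) (Determinant.det ?M) = Determinant.det (?G * ?M * ?H)"
    by (simp add: L.hom_det[symmetric] lin_act_cyclic_block_mat)
  also have "\<dots> = Determinant.det ?G * Determinant.det ?M * Determinant.det ?H"
    by (simp add: det_mult[OF GM] det_mult[OF _ carr])
  also have "\<dots> = Const ((det2 g * det2 h) ^ ?s) * Determinant.det ?M"
    by (simp only: det_blk power_mult_distrib C.hom_mult mult_ac)
  finally show ?thesis by (simp add: assms)
qed

lemma lookup_multihom_component:
  "Poly_Mapping.lookup (multihom_component \<delta> f) \<mu> =
    (Poly_Mapping.lookup f \<mu> when multidegree \<mu> = \<delta>)"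
  unfolding multihom_component_def
  by (auto simp: lookup_sum lookup_single when_def in_keys_iff sum.delta)

definition multihomogeneous :: "('m \<Rightarrow> nat) \<Rightarrow> ('m \<times> 4, 'k::field) mpoly \<Rightarrow> bool" where
  "multihomogeneous \<delta> f \<longleftrightarrow> (\<forall>\<mu>\<in>Poly_Mapping.keys f. multidegree \<mu> = \<delta>)"

lemma multihom_component_of_multihomogeneous:
  assumes "multihomogeneous \<epsilon> f"
  shows "multihom_component \<delta> f = (if \<epsilon> = \<delta> then f else 0)"
  using assms
  by (intro poly_mapping_eqI)
     (auto simp: lookup_multihom_component multihomogeneous_def when_def in_keys_iff)

lemma multihom_component_add:
  "multihom_component \<delta> (f + g) = multihom_component \<delta> f + multihom_component \<delta> g"
  by (rule poly_mapping_eqI) (simp add: lookup_multihom_component lookup_add when_def)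

lemma multidegree_add: "multidegree (\<mu> + \<nu>) = (\<lambda>i. multidegree \<mu> i + multidegree \<nu> i)"
  by (simp add: fun_eq_iff multidegree_def lookup_add sum.distrib)

lemma multidegree_single: "multidegree (Poly_Mapping.single (i, c) n) = (\<lambda>j. if j = i then n else 0)"
proof
  fix j
  have "multidegree (Poly_Mapping.single (i, c) n) j = (\<Sum>d\<in>UNIV. if d = c then (if j = i then n else 0) else 0)"
    unfolding multidegree_def by (intro sum.cong) (auto simp: lookup_single when_def)
  then show "multidegree (Poly_Mapping.single (i, c) n) j = (if j = i then n else 0)" by simp
qed

lemma multihomogeneous_mult:
  assumes "multihomogeneous \<delta> f" "multihomogeneous \<epsilon> g"
  shows "multihomogeneous (\<lambda>i. \<delta> i + \<epsilon> i) (f * g)"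
  using assms keys_mult[of f g] by (fastforce simp: multihomogeneous_def multidegree_add)

lemma multihomogeneous_sum:
  assumes "\<And>x. x \<in> X \<Longrightarrow> multihomogeneous \<delta> (f x)"
  shows "multihomogeneous \<delta> (sum f X)"
  using assms
proof (induction X rule: infinite_finite_induct)
  case (insert x X)
  then show ?case using keys_add[of "f x" "sum f X"] by (auto simp: multihomogeneous_def)
qed (auto simp: multihomogeneous_def)

lemma multihomogeneous_Const_mult:
  assumes "multihomogeneous \<delta> f" shows "multihomogeneous \<delta> (Const c * f)"
  using assms by (auto simp: multihomogeneous_def in_keys_iff lookup_Const_mult)

lemma multihomogeneous_lin_act_monomial:
  "multihomogeneous (multidegree \<mu>) (monom_eval (\<lambda>(i, c). \<Sum>d\<in>UNIV. Const (A $ c $ d) * Var (i, d)) \<mu>)"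
    (is "multihomogeneous _ (monom_eval ?\<phi> _)")
proof (induction \<mu> rule: poly_mapping_induct)
  case (single v n)
  obtain i c where v: "v = (i, c)" by (cases v)
  have one: "multihomogeneous (\<lambda>j. if j = i then 1 else 0) (?\<phi> (i, c))"
    unfolding split
    by (intro multihomogeneous_sum multihomogeneous_Const_mult)
       (auto simp: multihomogeneous_def Var_def multidegree_single)
  have "multihomogeneous (\<lambda>j. if j = i then n else 0) (?\<phi> (i, c) ^ n)"
  proof (induction n)
    case 0
    have "multidegree (0 :: 'a \<times> 4 \<Rightarrow>\<^sub>0 nat) = (\<lambda>j. 0)" by (simp add: multidegree_def fun_eq_iff)
    then show ?case by (simp add: multihomogeneous_def)
  next
    case (Suc n)
    have "(\<lambda>j. if j = i then Suc n else 0) = (\<lambda>j. (if j = i then 1 else 0) + (if j = i then n else 0))" by auto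
    then show ?case using multihomogeneous_mult[OF one Suc.IH] by simp
  qed
  then show ?case by (simp add: v multidegree_single)
next
  case (add \<mu> \<nu>)
  then show ?case by (simp add: monom_eval_add multidegree_add multihomogeneous_mult)
qed

lemma multihom_component_lin_act:
  "multihom_component \<delta> (lin_act A f) = lin_act A (multihom_component \<delta> f)"
proof -
  interpret comm_ring_hom "lin_act A" by (rule lin_act_hom)
  show ?thesis
  proof (induction f rule: poly_mapping_induct)
    case (single \<mu> c)
    have "multihomogeneous (multidegree \<mu>) (lin_act A (Poly_Mapping.single \<mu> c))"
      unfolding lin_act_def poly_subst_monomial
      by (intro multihomogeneous_Const_mult multihomogeneous_lin_act_monomial)
    moreover have "multihomogeneous (multidegree \<mu>) (Poly_Mapping.single \<mu> c)"
      by (simp add: multihomogeneous_def)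
    ultimately show ?case by (simp add: multihom_component_of_multihomogeneous)
  qed (simp add: hom_add multihom_component_add)
qed

lemma F_inv_invariant:
  assumes "CHAR('k::alg_closed_field) = 2"
  shows "(F_inv I J :: ('m \<times> 4, 'k) mpoly) \<in> invariants SO4"
  unfolding invariants_def
proof (intro CollectI ballI)
  fix A :: "'k ^ 4 ^ 4" assume "A \<in> SO4"
  then obtain g h where "A = two_sided g h" "det2 g * det2 h = 1"
    using SO4_two_sided[OF assms] by blast
  then show "lin_act A (F_inv I J) = F_inv I J"
    by (simp add: F_inv_def multihom_component_lin_act[symmetric] lin_act_det_cyclic_block_mat)
qed

section \<open>Squarefree coefficients\<close>

text \<open>The exponent of the monomial \<open>t\<^sub>A\<close>, the product of the variables in \<open>A\<close>.\<close>
definition sqfree :: "'m::finite set \<Rightarrow> 'm \<Rightarrow>\<^sub>0 nat" where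
  "sqfree A = (\<Sum>i\<in>A. Poly_Mapping.single i 1)"

lemma lookup_sqfree: "Poly_Mapping.lookup (sqfree A) i = (if i \<in> A then 1 else 0)"
  by (simp add: sqfree_def lookup_sum lookup_single when_def sum.delta)

lemma sqfree_eq_iff: "sqfree A = sqfree B \<longleftrightarrow> A = B"
proof
  assume "sqfree A = sqfree B"
  then have "i \<in> A \<longleftrightarrow> i \<in> B" for i
    by (metis lookup_sqfree zero_neq_one)
  then show "A = B" by auto
qed simp

lemma add_eq_sqfree_iff:
  "\<mu> + \<nu> = sqfree A \<longleftrightarrow> (\<exists>C\<subseteq>A. \<mu> = sqfree C \<and> \<nu> = sqfree (A - C))"
proof
  assume eq: "\<mu> + \<nu> = sqfree A"
  define C where "C = {i. Poly_Mapping.lookup \<mu> i = 1}"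
  have l: "Poly_Mapping.lookup \<mu> i + Poly_Mapping.lookup \<nu> i = (if i \<in> A then 1 else 0)" for i
    unfolding lookup_add[symmetric] eq lookup_sqfree ..
  have "C \<subseteq> A"
  proof
    fix i assume "i \<in> C" then show "i \<in> A" using l[of i] by (cases "i \<in> A") (auto simp: C_def)
  qed
  moreover have "\<mu> = sqfree C"
  proof (rule poly_mapping_eqI)
    fix i show "Poly_Mapping.lookup \<mu> i = Poly_Mapping.lookup (sqfree C) i"
      using l[of i] by (cases "i \<in> A") (auto simp: C_def lookup_sqfree)
  qed
  moreover have "\<nu> = sqfree (A - C)"
  proof (rule poly_mapping_eqI)
    fix i show "Poly_Mapping.lookup \<nu> i = Poly_Mapping.lookup (sqfree (A - C)) i"
      using l[of i] by (cases "i \<in> A") (auto simp: C_def lookup_sqfree)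
  qed
  ultimately show "\<exists>C\<subseteq>A. \<mu> = sqfree C \<and> \<nu> = sqfree (A - C)" by blast
next
  assume "\<exists>C\<subseteq>A. \<mu> = sqfree C \<and> \<nu> = sqfree (A - C)"
  then show "\<mu> + \<nu> = sqfree A"
    by (auto intro!: poly_mapping_eqI simp: lookup_add lookup_sqfree)
qed

lemma lookup_mult_sqfree:
  fixes f g :: "('m::finite, 'k::comm_ring_1) mpoly"
  shows "Poly_Mapping.lookup (f * g) (sqfree A) =
    (\<Sum>C\<in>Pow A. Poly_Mapping.lookup f (sqfree C) * Poly_Mapping.lookup g (sqfree (A - C)))"
proof (induction f rule: poly_mapping_induct)
  case (single \<mu> a)
  show ?case
  proof (induction g rule: poly_mapping_induct)
    case (single \<nu> b)
    show ?case
    proof (cases "\<mu> + \<nu> = sqfree A")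
      case True
      then obtain C where C: "C \<subseteq> A" "\<mu> = sqfree C" "\<nu> = sqfree (A - C)"
        using add_eq_sqfree_iff by metis
      have "(\<Sum>D\<in>Pow A. (a when \<mu> = sqfree D) * (b when \<nu> = sqfree (A - D))) =
        (\<Sum>D\<in>Pow A. if D = C then a * b else 0)"
        by (intro sum.cong) (auto simp: C sqfree_eq_iff when_def)
      then show ?thesis using C(1) True by (simp add: mult_single lookup_single sum.delta)
    next
      case False
      then have "\<mu> = sqfree D \<Longrightarrow> D \<subseteq> A \<Longrightarrow> \<nu> \<noteq> sqfree (A - D)" for D
        using add_eq_sqfree_iff by metis
      then have "(\<Sum>D\<in>Pow A. (a when \<mu> = sqfree D) * (b when \<nu> = sqfree (A - D))) = 0"
        by (intro sum.neutral) (auto simp: when_def)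
      then show ?thesis using False by (simp add: mult_single lookup_single)
    qed
  qed (simp add: distrib_left lookup_add sum.distrib)
qed (simp add: distrib_right lookup_add sum.distrib)

text \<open>The restrictions of decomposable invariants will lie in this set. Vanishing at \<open>t\<^sub>B\<close> for \<open>p \<notin> B\<close> is what
turns the coefficient of \<open>t\<^sub>N\<close> into a derivation at the origin when \<open>p \<in> N\<close>; vanishing at \<open>t\<^sub>N\<close> cuts out its kernel.\<close>
definition top_free :: "'m::finite \<Rightarrow> 'm set \<Rightarrow> ('m, 'k::comm_ring_1) mpoly set" where
  "top_free p N = {g. Poly_Mapping.lookup g (sqfree N) = 0 \<and>
     (\<forall>B. B \<noteq> {} \<and> p \<notin> B \<longrightarrow> Poly_Mapping.lookup g (sqfree B) = 0)}"

lemma top_free_Const: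
  assumes "N \<noteq> {}" shows "Const c \<in> top_free p N"
proof -
  have "0 = sqfree B \<longleftrightarrow> B = {}" for B :: "'a set"
    using sqfree_eq_iff[of "{}" B] by (auto simp: sqfree_def)
  then show ?thesis using assms by (simp add: top_free_def Const_def lookup_single_not_eq)
qed

lemma top_free_add:
  assumes "f \<in> top_free p N" "g \<in> top_free p N" shows "f + g \<in> top_free p N"
  using assms by (auto simp: top_free_def lookup_add)

text \<open>In a splitting \<open>t\<^sub>A = t\<^sub>C t\<^bsub>A-C\<^esub>\<close> at least one of the two index sets avoids \<open>p\<close>, and if it is empty then the
other one is \<open>A\<close> itself.\<close>
lemma top_free_mult:
  assumes "p \<in> N" and fg: "f \<in> top_free p N" "g \<in> top_free p N"
  shows "f * g \<in> top_free p N"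
proof -
  have "Poly_Mapping.lookup f (sqfree C) * Poly_Mapping.lookup g (sqfree (A - C)) = 0"
    if "C \<subseteq> A" "A = N \<or> A \<noteq> {} \<and> p \<notin> A" for A C
  proof (cases "C = {}")
    case True
    then show ?thesis using fg that by (auto simp: top_free_def)
  next
    case False
    then show ?thesis
    proof (cases "p \<in> C")
      case False
      then show ?thesis using fg \<open>C \<noteq> {}\<close> by (auto simp: top_free_def)
    next
      case True
      then have "A = N" using that by auto
      show ?thesis
      proof (cases "C = N")
        case False
        then have "A - C \<noteq> {}" "p \<notin> A - C" using that \<open>A = N\<close> True by auto
        then show ?thesis using fg by (auto simp: top_free_def)
      qed (use fg in \<open>auto simp: top_free_def\<close>)
    qed
  qed
  then have "Poly_Mapping.lookup (f * g) (sqfree A) = 0" if "A = N \<or> A \<noteq> {} \<and> p \<notin> A" for A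
    unfolding lookup_mult_sqfree by (intro sum.neutral) (use that in auto)
  then show ?thesis by (simp add: top_free_def)
qed
section \<open>Restriction to scalar matrices\<close>

text \<open>Restriction to \<open>V\<^sup>i = diag(t\<^sub>i, t\<^sub>i)\<close> for \<open>i \<noteq> p\<close> and \<open>V\<^sup>p = diag(t\<^sub>p, 0)\<close>: the coordinates \<open>1\<close> and \<open>3\<close> are
\<open>x\<^sub>1\<close> and \<open>y\<^sub>1\<close>. Killing one entry at \<open>p\<close> selects one monomial from each pair that the exchange of
\<open>x\<^sub>1\<close> and \<open>y\<^sub>1\<close> forms among those involving \<open>p\<close>; otherwise all nonconstant squarefree coefficients of restricted
invariants would vanish.\<close>
definition scalar_restriction :: "'m \<Rightarrow> ('m \<times> 4, 'k::field) mpoly \<Rightarrow> ('m, 'k) mpoly" where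
  "scalar_restriction p = poly_subst (\<lambda>(i, c). if c = 1 \<or> c = 3 \<and> i \<noteq> p then Var i else 0)"

text \<open>The monomials that do not restrict to \<open>0\<close>.\<close>
definition scalar_monom :: "'m \<Rightarrow> ('m \<times> 4 \<Rightarrow>\<^sub>0 nat) \<Rightarrow> bool" where
  "scalar_monom p \<mu> \<longleftrightarrow> (\<forall>(i, c)\<in>Poly_Mapping.keys \<mu>. c = 1 \<or> c = 3 \<and> i \<noteq> p)"

text \<open>The exponent of the restriction of a monomial that does not restrict to \<open>0\<close>.\<close>
definition multidegree_monom :: "('m::finite \<times> 4 \<Rightarrow>\<^sub>0 nat) \<Rightarrow> 'm \<Rightarrow>\<^sub>0 nat" where
  "multidegree_monom \<mu> = (\<Sum>i\<in>UNIV. Poly_Mapping.single i (multidegree \<mu> i))"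

lemma lookup_multidegree_monom: "Poly_Mapping.lookup (multidegree_monom \<mu>) i = multidegree \<mu> i"
  by (simp add: multidegree_monom_def lookup_sum lookup_single when_def sum.delta)

lemma multidegree_monom_eq_sqfree:
  "multidegree_monom \<mu> = sqfree A \<longleftrightarrow> multidegree \<mu> = (\<lambda>i. if i \<in> A then 1 else 0)"
  by (simp add: poly_mapping_eq_iff fun_eq_iff lookup_multidegree_monom lookup_sqfree)

lemma keys_add_nat:
  fixes \<mu> \<nu> :: "'v \<Rightarrow>\<^sub>0 nat"
  shows "Poly_Mapping.keys (\<mu> + \<nu>) = Poly_Mapping.keys \<mu> \<union> Poly_Mapping.keys \<nu>"
  by (auto simp: in_keys_iff lookup_add)

lemma Var_power: "Var i ^ n = Poly_Mapping.single (Poly_Mapping.single i n) 1"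
  by (induction n) (simp_all add: Var_def mult_single flip: single_add)

lemma monom_eval_scalar:
  fixes \<mu> :: "'m::finite \<times> 4 \<Rightarrow>\<^sub>0 nat"
  shows "monom_eval (\<lambda>(i, c). if c = 1 \<or> c = 3 \<and> i \<noteq> p then Var i else 0) \<mu> =
    (if scalar_monom p \<mu> then Poly_Mapping.single (multidegree_monom \<mu>) (1 :: 'k::comm_ring_1) else 0)"
proof (induction \<mu> rule: poly_mapping_induct)
  case (single v n)
  obtain i c where v: "v = (i, c)" by (cases v)
  have "multidegree_monom (Poly_Mapping.single (i, c) n) = Poly_Mapping.single i n"
    by (rule poly_mapping_eqI) (simp add: lookup_multidegree_monom multidegree_single lookup_single when_def)
  then show ?case by (auto simp: v scalar_monom_def Var_power power_0_left)
next
  case (add \<mu> \<nu>)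
  have "multidegree_monom (\<mu> + \<nu>) = multidegree_monom \<mu> + multidegree_monom \<nu>"
    by (rule poly_mapping_eqI) (simp add: lookup_multidegree_monom multidegree_add lookup_add)
  moreover have "scalar_monom p (\<mu> + \<nu>) \<longleftrightarrow> scalar_monom p \<mu> \<and> scalar_monom p \<nu>"
    by (auto simp: scalar_monom_def keys_add_nat)
  ultimately show ?case by (simp add: monom_eval_add add.IH mult_single)
qed

lemma lookup_scalar_restriction:
  fixes f :: "('m::finite \<times> 4, 'k::field) mpoly"
  shows "Poly_Mapping.lookup (scalar_restriction p f) (sqfree A) =
    (\<Sum>\<mu> | \<mu> \<in> Poly_Mapping.keys f \<and> scalar_monom p \<mu> \<and>
        multidegree \<mu> = (\<lambda>i. if i \<in> A then 1 else 0). Poly_Mapping.lookup f \<mu>)"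
proof -
  have "scalar_restriction p f = (\<Sum>\<mu>\<in>Poly_Mapping.keys f. Const (Poly_Mapping.lookup f \<mu>) *
     (if scalar_monom p \<mu> then Poly_Mapping.single (multidegree_monom \<mu>) 1 else 0))"
    unfolding scalar_restriction_def poly_subst_def insertion_def
    unfolding monom_eval_def[symmetric] monom_eval_scalar ..
  then have "Poly_Mapping.lookup (scalar_restriction p f) (sqfree A) =
     (\<Sum>\<mu>\<in>Poly_Mapping.keys f. if scalar_monom p \<mu> \<and> multidegree \<mu> = (\<lambda>i. if i \<in> A then 1 else 0)
        then Poly_Mapping.lookup f \<mu> else 0)"
    by (auto simp: lookup_sum lookup_Const_mult lookup_single multidegree_monom_eq_sqfree[symmetric] when_def
        intro!: sum.cong)
  then show ?thesis by (simp add: sum.inter_filter)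
qed

definition swap_coords :: "'m \<times> 4 \<Rightarrow> 'm \<times> 4" where
  "swap_coords = (\<lambda>(i, c). (i, swap4 c))"

lemma swap4_swap4 [simp]: "swap4 (swap4 c) = c"
  using exhaust_4[of c] by auto

lemma swap_coords_involution: "swap_coords (swap_coords v) = v"
  by (simp add: swap_coords_def split: prod.splits)

lemma inj_swap_coords: "inj swap_coords"
  by (metis injI swap_coords_involution)

abbreviation swap_monom :: "('m \<times> 4 \<Rightarrow>\<^sub>0 nat) \<Rightarrow> ('m \<times> 4 \<Rightarrow>\<^sub>0 nat)" where
  "swap_monom \<equiv> Poly_Mapping.map_key swap_coords"

lemma lookup_swap_monom: "Poly_Mapping.lookup (swap_monom \<mu>) v = Poly_Mapping.lookup \<mu> (swap_coords v)"
  by (simp add: map_key.rep_eq inj_swap_coords)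

lemma lookup_swap_monom_pair:
  "Poly_Mapping.lookup (swap_monom \<mu>) (i, c) = Poly_Mapping.lookup \<mu> (i, swap4 c)"
  by (simp add: lookup_swap_monom) (simp add: swap_coords_def)

lemma swap_monom_involution: "swap_monom (swap_monom \<mu>) = \<mu>"
  by (rule poly_mapping_eqI) (simp add: lookup_swap_monom swap_coords_involution)

lemma monom_eval_swap:
  "monom_eval (\<lambda>v. Var (swap_coords v)) \<mu> = Poly_Mapping.single (swap_monom \<mu>) (1 :: 'k::comm_ring_1)"
proof (induction \<mu> rule: poly_mapping_induct)
  case (single v n)
  have "swap_monom (Poly_Mapping.single v n) = Poly_Mapping.single (swap_coords v) n"
    using map_key_single[OF inj_swap_coords, of "swap_coords v"] by (simp add: swap_coords_involution)
  then show ?case by (simp add: Var_power)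
next
  case (add \<mu> \<nu>)
  then show ?case by (simp add: monom_eval_add mult_single map_key_plus[OF inj_swap_coords])
qed

text \<open>The exchange of coordinates permutes the monomials, and with them the coefficients.\<close>
lemma lookup_lin_act_swap:
  fixes f :: "('m \<times> 4, 'k::field) mpoly"
  shows "Poly_Mapping.lookup (lin_act swap_mat f) \<mu> =
    Poly_Mapping.lookup f (swap_monom \<mu>)"
proof -
  interpret C: comm_ring_hom "Const :: 'k \<Rightarrow> ('m \<times> 4, 'k) mpoly" by (rule comm_ring_hom_Const)
  have sub: "(\<lambda>(i, c). \<Sum>d\<in>UNIV. Const (swap_mat $ c $ d) * Var (i, d)) =
     (\<lambda>v. Var (swap_coords v) :: ('m \<times> 4, 'k) mpoly)"
    by (auto simp: swap_mat_def swap_coords_def if_distrib[of Const] if_distrib[of "\<lambda>x. x * _"] cong: if_cong)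
  show ?thesis unfolding lin_act_def sub
  proof (induction f rule: poly_mapping_induct)
    case (single \<nu> c)
    have "swap_monom \<nu> = \<mu> \<longleftrightarrow> \<nu> = swap_monom \<mu>" using swap_monom_involution by metis
    then show ?case
      by (simp add: poly_subst_monomial monom_eval_swap lookup_Const_mult lookup_single when_def)
  next
    case (add p q)
    then show ?case
      by (simp add: poly_subst_def insertion_add[OF comm_ring_hom_Const] lookup_add)
  qed
qed

lemma multidegree_swap_monom: "multidegree (swap_monom \<mu>) = multidegree \<mu>"
  by (simp add: multidegree_def lookup_swap_monom_pair sum_4 fun_eq_iff add_ac)

text \<open>The monomials that restrict to \<open>t\<^sub>B\<close> contain, for a chosen \<open>b \<in> B\<close>, exactly one of \<open>x\<^sub>1\<close> and \<open>y\<^sub>1\<close> of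
the \<open>b\<close>-th vector, to the first power. The exchange is a bijection between the two sorts that preserves the
coefficients of \<open>f\<close>; the condition \<open>p \<notin> B\<close> keeps it inside the set of monomials that do not restrict to \<open>0\<close>.\<close>
lemma scalar_restriction_swap_invariant:
  fixes f :: "('m::finite \<times> 4, 'k::field) mpoly"
  assumes char: "CHAR('k) = 2"
    and inv: "lin_act swap_mat f = f"
    and B: "B \<noteq> {}" "p \<notin> B"
  shows "Poly_Mapping.lookup (scalar_restriction p f) (sqfree B) = 0"
proof -
  define X where "X = {\<mu>. \<mu> \<in> Poly_Mapping.keys f \<and> scalar_monom p \<mu> \<and>
        multidegree \<mu> = (\<lambda>i. if i \<in> B then 1 else 0)}"
  have "finite X" by (simp add: X_def)
  have swap_lookup: "Poly_Mapping.lookup f (swap_monom \<mu>) = Poly_Mapping.lookup f \<mu>" for \<mu>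
    using lookup_lin_act_swap[of f \<mu>] inv by simp
  have X_swap: "swap_monom \<mu> \<in> X" if "\<mu> \<in> X" for \<mu>
  proof -
    have \<mu>: "\<mu> \<in> Poly_Mapping.keys f" "scalar_monom p \<mu>"
      "multidegree \<mu> = (\<lambda>i. if i \<in> B then 1 else 0)" using that by (auto simp: X_def)
    have "c = 1 \<or> c = 3 \<and> i \<noteq> p" if "(i, c) \<in> Poly_Mapping.keys (swap_monom \<mu>)" for i c
    proof -
      have k: "(i, swap4 c) \<in> Poly_Mapping.keys \<mu>"
        using that by (simp add: in_keys_iff lookup_swap_monom_pair)
      then have "swap4 c = 1 \<or> swap4 c = 3" using \<mu>(2) by (auto simp: scalar_monom_def)
      then have "c = 1 \<or> c = 3" using exhaust_4[of c] by auto
      moreover have "multidegree \<mu> i \<noteq> 0" using k by (auto simp: multidegree_def in_keys_iff)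
      then have "i \<noteq> p" using \<mu>(3) B(2) by auto
      ultimately show ?thesis by auto
    qed
    then have "scalar_monom p (swap_monom \<mu>)" by (auto simp: scalar_monom_def)
    then show ?thesis using \<mu>
      by (simp add: X_def in_keys_iff swap_lookup multidegree_swap_monom)
  qed
  obtain b where b: "b \<in> B" using B(1) by blast
  have one: "Poly_Mapping.lookup \<mu> (b, 1) + Poly_Mapping.lookup \<mu> (b, 3) = 1" if "\<mu> \<in> X" for \<mu>
  proof -
    have diag: "scalar_monom p \<mu>" using that by (simp add: X_def)
    have "c = 1 \<or> c = 3" if "(b, c) \<in> Poly_Mapping.keys \<mu>" for c
      using diag that by (auto simp: scalar_monom_def)
    from this[of 2] this[of 4] have "(b, 2) \<notin> Poly_Mapping.keys \<mu>" "(b, 4) \<notin> Poly_Mapping.keys \<mu>"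
      by auto
    then have "Poly_Mapping.lookup \<mu> (b, 2) = 0" "Poly_Mapping.lookup \<mu> (b, 4) = 0"
      by (simp_all add: in_keys_iff)
    moreover have "multidegree \<mu> b = 1" using that b by (simp add: X_def)
    ultimately show ?thesis by (simp add: multidegree_def sum_4)
  qed
  let ?X1 = "{\<mu>\<in>X. Poly_Mapping.lookup \<mu> (b, 1) = 1}"
  let ?X3 = "{\<mu>\<in>X. Poly_Mapping.lookup \<mu> (b, 3) = 1}"
  let ?S = "sum (Poly_Mapping.lookup f)"
  have "\<mu> \<in> X \<longleftrightarrow> \<mu> \<in> ?X1 \<union> ?X3" for \<mu> using one[of \<mu>] by (auto simp: add_is_1)
  then have "X = ?X1 \<union> ?X3" by blast
  moreover have "?X1 \<inter> ?X3 = {}"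
  proof -
    have False if "\<mu> \<in> ?X1" "\<mu> \<in> ?X3" for \<mu> using one[of \<mu>] that by simp
    then show ?thesis by blast
  qed
  ultimately have "?S X = ?S ?X1 + ?S ?X3"
    using \<open>finite X\<close> by (metis (no_types, lifting) finite_Un sum.union_disjoint)
  also have "?S ?X3 = ?S ?X1"
    by (rule sum.reindex_bij_witness[of _ swap_monom swap_monom])
       (auto simp: swap_monom_involution X_swap swap_lookup lookup_swap_monom_pair)
  also have "?S ?X1 + ?S ?X1 = 0" by (rule char2_add_self[OF char])
  finally show ?thesis by (simp add: lookup_scalar_restriction X_def)
qed

section \<open>The value on \<open>F\<close>\<close>
lemma signof_char2:
  assumes "CHAR('k::comm_ring_1) = 2"
  shows "(signof \<pi> :: ('m, 'k) mpoly) = 1"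
proof -
  have "- (1 :: ('m, 'k) mpoly) = 1"
    by (rule poly_mapping_eqI) (simp add: char2_minus[OF assms])
  then show ?thesis by (simp add: sign_def)
qed

text \<open>The permanent of a matrix with two possibly nonzero entries in each row, \<open>a r\<close> in column \<open>r\<close> and \<open>b r\<close>
in column \<open>\<sigma> r\<close> (added up if \<open>\<sigma> r = r\<close>). Expanding the products, \<open>E\<close> is the set of rows in which \<open>a r\<close> is
chosen; it determines the permutation.\<close>
lemma sum_permutations_two_choices:
  fixes a b :: "'i \<Rightarrow> 'r::comm_ring_1"
  assumes U: "finite U"
  shows "(\<Sum>\<pi> | \<pi> permutes U. \<Prod>r\<in>U. (if \<pi> r = r then a r else 0) + (if \<pi> r = \<sigma> r then b r else 0)) =
    (\<Sum>E\<in>Pow U. if (\<lambda>r. if r \<in> U - E then \<sigma> r else r) permutes U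
       then (\<Prod>r\<in>E. a r) * (\<Prod>r\<in>U - E. b r) else 0)"
proof -
  define q where "q E = (\<lambda>r. if r \<in> U - E then \<sigma> r else r)" for E
  have expand: "(\<Prod>r\<in>U. (if \<pi> r = r then a r else 0) + (if \<pi> r = \<sigma> r then b r else 0)) =
    (\<Sum>E\<in>Pow U. if \<pi> = q E then (\<Prod>r\<in>E. a r) * (\<Prod>r\<in>U - E. b r) else 0)"
    if \<pi>: "\<pi> permutes U" for \<pi>
  proof -
    have "(\<Prod>r\<in>E. if \<pi> r = r then a r else 0) * (\<Prod>r\<in>U - E. if \<pi> r = \<sigma> r then b r else 0) =
      (if \<pi> = q E then (\<Prod>r\<in>E. a r) * (\<Prod>r\<in>U - E. b r) else 0)" if E: "E \<subseteq> U" for E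
    proof (cases "\<pi> = q E")
      case True
      have "(\<Prod>r\<in>E. if \<pi> r = r then a r else 0) = (\<Prod>r\<in>E. a r)"
        "(\<Prod>r\<in>U - E. if \<pi> r = \<sigma> r then b r else 0) = (\<Prod>r\<in>U - E. b r)"
        by (intro prod.cong; simp add: True q_def)+
      then show ?thesis using True by simp
    next
      case False
      then obtain r where r: "\<pi> r \<noteq> q E r" by auto
      have "r \<in> U" by (rule ccontr) (use r permutes_not_in[OF \<pi>, of r] in \<open>simp add: q_def\<close>)
      have fin: "finite E" "finite (U - E)" using U E finite_subset by auto
      show ?thesis
      proof (cases "r \<in> E")
        case True
        then have "(\<Prod>r\<in>E. if \<pi> r = r then a r else 0) = 0"
          using r by (intro prod_zero fin bexI[of _ r]) (auto simp: q_def)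
        then show ?thesis using False by simp
      next
        case rE: False
        then have "(\<Prod>r\<in>U - E. if \<pi> r = \<sigma> r then b r else 0) = 0"
          using r \<open>r \<in> U\<close> by (intro prod_zero fin bexI[of _ r]) (auto simp: q_def)
        then show ?thesis using False by simp
      qed
    qed
    then show ?thesis by (subst prod_add[OF U]) (auto intro!: sum.cong)
  qed
  have "(\<Sum>\<pi> | \<pi> permutes U. \<Prod>r\<in>U. (if \<pi> r = r then a r else 0) + (if \<pi> r = \<sigma> r then b r else 0)) =
    (\<Sum>\<pi> | \<pi> permutes U. \<Sum>E\<in>Pow U. if \<pi> = q E then (\<Prod>r\<in>E. a r) * (\<Prod>r\<in>U - E. b r) else 0)"
    by (intro sum.cong) (auto simp: expand)
  also have "\<dots> = (\<Sum>E\<in>Pow U. \<Sum>\<pi> | \<pi> permutes U. if \<pi> = q E then (\<Prod>r\<in>E. a r) * (\<Prod>r\<in>U - E. b r) else 0)"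
    by (rule sum.swap)
  also have "\<dots> = (\<Sum>E\<in>Pow U. if q E permutes U then (\<Prod>r\<in>E. a r) * (\<Prod>r\<in>U - E. b r) else 0)"
    using finite_permutations[OF U] by (simp add: sum.delta)
  finally show ?thesis unfolding q_def .
qed

text \<open>The column of the entry from \<open>V\<^bsup>j\<^esup>\<close> in row \<open>r\<close> after restriction: the same position in the next of the \<open>s\<close> blocks,
cyclically. For \<open>s = 1\<close> this is \<open>r\<close> itself.\<close>
definition next_block :: "nat \<Rightarrow> nat \<Rightarrow> nat" where
  "next_block s r = 2 * ((r div 2 + 1) mod s) + r mod 2"

lemma next_block_simps:
  assumes "r < 2 * s"
  shows "next_block s r div 2 = (r div 2 + 1) mod s" "next_block s r mod 2 = r mod 2" "next_block s r < 2 * s"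
proof -
  have "(r div 2 + 1) mod s < s" using assms by (intro mod_less_divisor) auto
  then have "2 * ((r div 2 + 1) mod s) + r mod 2 < 2 * s" by linarith
  then show "next_block s r div 2 = (r div 2 + 1) mod s" "next_block s r mod 2 = r mod 2" "next_block s r < 2 * s"
    by (simp_all add: next_block_def)
qed

lemma eq_next_block_iff:
  assumes "r < 2 * s"
  shows "c = next_block s r \<longleftrightarrow> c div 2 = (r div 2 + 1) mod s \<and> c mod 2 = r mod 2"
proof
  assume "c div 2 = (r div 2 + 1) mod s \<and> c mod 2 = r mod 2"
  moreover have "c = 2 * (c div 2) + c mod 2" by simp
  ultimately show "c = next_block s r" unfolding next_block_def by metis
qed (simp add: next_block_simps[OF assms])

lemma inj_on_next_block: "inj_on (next_block s) {0..<2 * s}"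
proof (rule inj_onI)
  fix x y assume x: "x \<in> {0..<2 * s}" and y: "y \<in> {0..<2 * s}" and eq: "next_block s x = next_block s y"
  have m: "x mod 2 = y mod 2" "(x div 2 + 1) mod s = (y div 2 + 1) mod s"
    using next_block_simps[of x s] next_block_simps[of y s] x y eq by auto
  have "x div 2 < s" "y div 2 < s" using x y by auto
  then have "x div 2 = y div 2" using m(2) by (auto simp: mod_Suc split: if_splits)
  then show "x = y" using m(1) by (metis div_mult_mod_eq)
qed

text \<open>A row outside \<open>E\<close> is sent to the next block, so by injectivity its image cannot be a fixed row in \<open>E\<close>. As the
blocks are arranged cyclically, each of the two parity classes of rows lies inside \<open>E\<close> or outside of it.\<close>
lemma next_block_closed:
  assumes "E \<subseteq> {0..<2 * s}"
    and perm: "(\<lambda>r. if r \<in> {0..<2 * s} - E then next_block s r else r) permutes {0..<2 * s}"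
    and t: "t < s" and t': "t' < s" and e: "e < 2" and "2 * t + e \<notin> E"
  shows "2 * t' + e \<notin> E"
proof -
  let ?U = "{0..<2 * s}"
  let ?q = "\<lambda>r. if r \<in> ?U - E then next_block s r else r"
  have step: "next_block s r \<notin> E" if "r \<in> ?U" "r \<notin> E" for r
  proof
    assume n: "next_block s r \<in> E"
    moreover have "next_block s r \<in> ?U" using next_block_simps(3)[of r s] that by simp
    ultimately have "?q (next_block s r) = ?q r" using that by simp
    then have "next_block s r = r" by (rule injD[OF permutes_inj[OF perm]])
    then show False using n that by simp
  qed
  have "2 * ((t + k) mod s) + e \<notin> E" for k
  proof (induction k)
    case 0
    then show ?case using assms by simp
  next
    case (Suc k)
    let ?r = "2 * ((t + k) mod s) + e"
    have "(t + k) mod s < s" using t by (intro mod_less_divisor) auto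
    then have "?r \<in> ?U" using e by auto
    then have "next_block s ?r \<notin> E" using step Suc.IH by blast
    moreover have "next_block s ?r = 2 * ((t + Suc k) mod s) + e"
      using e by (simp add: next_block_def mod_Suc_eq)
    ultimately show ?case by simp
  qed
  from this[of "s - t + t'"] show ?thesis using t t' by simp
qed

lemma prod_Var_eq_sqfree:
  "(\<Prod>i\<in>A. Var i :: ('m::finite, 'k::comm_ring_1) mpoly) = Poly_Mapping.single (sqfree A) 1"
proof (induction A rule: infinite_finite_induct)
  case (insert i A)
  then show ?case by (simp add: sqfree_def Var_def mult_single)
qed (simp_all add: sqfree_def)

text \<open>The choice sets \<open>E\<close> that give a permutation are unions of parity classes. The odd rows cannot be in \<open>E\<close>,
since their class contains row \<open>1\<close>, where the entry from \<open>V\<^sup>p\<close> is the one set to \<open>0\<close>. The empty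
choice gives the square of the product of the \<open>t\<^sub>j\<close>, and the even rows give \<open>t\<^sub>N\<close>.\<close>
lemma scalar_restriction_det:
  fixes I J :: "'m::finite list"
  assumes char: "CHAR('k::field) = 2"
    and s: "s \<ge> 1" "length I = s" "length J = s" and dist: "distinct (I @ J)"
  shows "Poly_Mapping.lookup (scalar_restriction (hd I) (Determinant.det (cyclic_block_mat I J :: ('m \<times> 4, 'k) mpoly mat)))
     (sqfree (set I \<union> set J)) = 1"
proof -
  let ?p = "hd I" and ?U = "{0..<2 * s}" and ?N = "set I \<union> set J"
  let ?M = "cyclic_block_mat I J :: ('m \<times> 4, 'k) mpoly mat"
  let ?\<tau> = "scalar_restriction ?p :: ('m \<times> 4, 'k) mpoly \<Rightarrow> ('m, 'k) mpoly"
  interpret comm_ring_hom ?\<tau> unfolding scalar_restriction_def by (rule poly_subst_hom)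
  define a where "a r = (if r = 1 then 0 else Var (I ! (r div 2)) :: ('m, 'k) mpoly)" for r
  define b where "b r = (Var (J ! (r div 2)) :: ('m, 'k) mpoly)" for r
  have hd: "?p = I ! 0" using s by (metis hd_conv_nth length_0_conv not_one_le_zero)
  have p: "I ! t = ?p \<longleftrightarrow> t = 0" "J ! t \<noteq> ?p" if "t < s" for t
  proof -
    show "I ! t = ?p \<longleftrightarrow> t = 0" using that s dist unfolding hd by (simp add: nth_eq_iff_index_eq)
    have "J ! t \<in> set J" "?p \<in> set I" using that s hd by (auto intro: nth_mem)
    then show "J ! t \<noteq> ?p" using dist by auto
  qed
  have trace_Var: "?\<tau> (Var (i, c)) = (if c = 1 \<or> c = 3 \<and> i \<noteq> ?p then Var i else 0)" for i c
    by (simp add: scalar_restriction_def poly_subst_Var)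
  have trace_V: "?\<tau> (V_mat i $$ (x, y)) = (if x = y \<and> \<not> (x = 1 \<and> i = ?p) then Var i else 0)"
    if "x < 2" "y < 2" for i x y
    using less_2_cases[OF that(1)] less_2_cases[OF that(2)] by (elim disjE) (simp_all add: trace_Var)
  have entry: "?\<tau> (?M $$ (r, c)) = (if c = r then a r else 0) + (if c = next_block s r then b r else 0)"
    if "r \<in> ?U" "c \<in> ?U" for r c
  proof -
    have rc: "r < 2 * s" "c < 2 * s" and lt: "r div 2 < s" "c div 2 < s" using that by auto
    have eq: "c = r \<longleftrightarrow> c div 2 = r div 2 \<and> c mod 2 = r mod 2" by (metis div_mult_mod_eq)
    have one: "r = 1 \<longleftrightarrow> r mod 2 = 1 \<and> r div 2 = 0" by auto
    have "?M $$ (r, c) = ?M $$ (2 * (r div 2) + r mod 2, 2 * (c div 2) + c mod 2)" by simp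
    also have "\<dots> = (if c div 2 = r div 2 then V_mat (I ! (r div 2)) $$ (r mod 2, c mod 2) else 0) +
       (if c div 2 = (r div 2 + 1) mod s then V_mat (J ! (r div 2)) $$ (r mod 2, c mod 2) else 0)"
      by (subst cyclic_block_mat_entry) (use lt s in auto)
    finally have "?\<tau> (?M $$ (r, c)) =
       (if c div 2 = r div 2 then ?\<tau> (V_mat (I ! (r div 2)) $$ (r mod 2, c mod 2)) else 0) +
       (if c div 2 = (r div 2 + 1) mod s then ?\<tau> (V_mat (J ! (r div 2)) $$ (r mod 2, c mod 2)) else 0)"
      by (simp add: hom_add)
    also have "\<dots> = (if c = r then a r else 0) + (if c = next_block s r then b r else 0)"
    proof -
      have V: "?\<tau> (V_mat i $$ (r mod 2, c mod 2)) =
          (if r mod 2 = c mod 2 \<and> \<not> (r mod 2 = 1 \<and> i = ?p) then Var i else 0)" for i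
        by (rule trace_V) simp_all
      show ?thesis
        unfolding V eq eq_next_block_iff[OF rc(1)] a_def b_def one p(1)[OF lt(1)]
        by (rule arg_cong2[of _ _ _ _ "(+)"]) (use p(2)[OF lt(1)] in \<open>simp_all\<close>)
    qed
    finally show ?thesis .
  qed
  have carr: "map_mat ?\<tau> ?M \<in> carrier_mat (2 * s) (2 * s)"
    using cyclic_block_mat_carrier[of I J] s by simp
  have \<pi>_less: "\<pi> r \<in> ?U" if "\<pi> permutes ?U" "r \<in> ?U" for \<pi> r
    using permutes_in_image[OF that(1)] that(2) by blast
  have map_entry: "map_mat ?\<tau> ?M $$ (r, c) = (if c = r then a r else 0) + (if c = next_block s r then b r else 0)"
    if "r \<in> ?U" "c \<in> ?U" for r c
    using entry[OF that] that carr by simp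
  have "?\<tau> (Determinant.det ?M) = Determinant.det (map_mat ?\<tau> ?M)" by (rule hom_det[symmetric])
  also have "\<dots> = (\<Sum>\<pi> | \<pi> permutes ?U. \<Prod>r\<in>?U. map_mat ?\<tau> ?M $$ (r, \<pi> r))"
    unfolding det_def'[OF carr] signof_char2[OF char] by simp
  also have "\<dots> = (\<Sum>\<pi> | \<pi> permutes ?U. \<Prod>r\<in>?U. (if \<pi> r = r then a r else 0) + (if \<pi> r = next_block s r then b r else 0))"
    by (rule sum.cong[OF refl], rule prod.cong[OF refl], rule map_entry) (simp_all only: mem_Collect_eq \<pi>_less)
  also have "\<dots> = (\<Sum>E\<in>Pow ?U. if (\<lambda>r. if r \<in> ?U - E then next_block s r else r) permutes ?U
       then (\<Prod>r\<in>E. a r) * (\<Prod>r\<in>?U - E. b r) else 0)"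
    by (rule sum_permutations_two_choices) simp
  finally have det: "?\<tau> (Determinant.det ?M) = (\<Sum>E\<in>Pow ?U.
       if (\<lambda>r. if r \<in> ?U - E then next_block s r else r) permutes ?U
       then (\<Prod>r\<in>E. a r) * (\<Prod>r\<in>?U - E. b r) else 0)" .
  have split_parity: "\<exists>t<s. r = 2 * t \<or> r = 2 * t + 1" if "r \<in> ?U" for r
    by (rule exI[of _ "r div 2"]) (use that in auto)
  define E0 where "E0 = {r \<in> ?U. even r}"
  have E0_image: "E0 = (\<lambda>t. 2 * t) ` {0..<s}" by (auto simp: E0_def elim!: evenE)
  have odd_image: "?U - E0 = (\<lambda>t. 2 * t + 1) ` {0..<s}"
  proof (intro subset_antisym subsetI)
    fix r assume r: "r \<in> ?U - E0"
    then obtain t where "t < s" "r = 2 * t \<or> r = 2 * t + 1" using split_parity by blast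
    then show "r \<in> (\<lambda>t. 2 * t + 1) ` {0..<s}" using r by (auto simp: E0_def)
  qed (auto simp: E0_def)
  have prod_nth: "(\<Prod>t\<in>{0..<s}. Var (L ! t) :: ('m, 'k) mpoly) = (\<Prod>i\<in>set L. Var i)"
    if "length L = s" "distinct L" for L
    using that by (intro prod.reindex_bij_betw) (metis atLeast0LessThan bij_betw_nth)
  have prodE0: "(\<Prod>r\<in>E0. a r) * (\<Prod>r\<in>?U - E0. b r) = Poly_Mapping.single (sqfree ?N) 1"
  proof -
    have "(\<Prod>r\<in>E0. a r) = (\<Prod>t\<in>{0..<s}. Var (I ! t))"
      unfolding E0_image by (subst prod.reindex) (auto simp: inj_on_def a_def intro!: prod.cong)
    moreover have "(\<Prod>r\<in>?U - E0. b r) = (\<Prod>t\<in>{0..<s}. Var (J ! t))"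
      unfolding odd_image by (subst prod.reindex) (auto simp: inj_on_def b_def intro!: prod.cong)
    ultimately have "(\<Prod>r\<in>E0. a r) * (\<Prod>r\<in>?U - E0. b r) = (\<Prod>i\<in>set I. Var i) * (\<Prod>i\<in>set J. Var i)"
      using prod_nth[of I] prod_nth[of J] s dist by simp
    also have "\<dots> = (\<Prod>i\<in>?N. Var i)"
      using dist by (subst prod.union_disjoint) auto
    finally show ?thesis by (simp add: prod_Var_eq_sqfree)
  qed
  have permE0: "(\<lambda>r. if r \<in> ?U - E0 then next_block s r else r) permutes ?U"
  proof (rule bij_imp_permutes)
    let ?q = "\<lambda>r. if r \<in> ?U - E0 then next_block s r else r"
    have par: "?q r mod 2 = r mod 2" "?q r \<in> ?U" if "r \<in> ?U" for r
      using next_block_simps[of r s] that by auto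
    have "inj_on ?q ?U"
    proof (rule inj_onI)
      fix x y assume xy: "x \<in> ?U" "y \<in> ?U" "?q x = ?q y"
      have "x mod 2 = ?q x mod 2" by (rule par(1)[OF xy(1), symmetric])
      also have "\<dots> = ?q y mod 2" by (simp only: xy(3))
      also have "\<dots> = y mod 2" by (rule par(1)[OF xy(2)])
      finally have "x mod 2 = y mod 2" .
      then have "x \<in> E0 \<longleftrightarrow> y \<in> E0" using xy(1,2) by (simp add: E0_def even_iff_mod_2_eq_zero)
      then show "x = y"
        using xy inj_onD[OF inj_on_next_block, of s x y] by (cases "x \<in> E0") simp_all
    qed
    moreover have "?q ` ?U = ?U"
      by (rule endo_inj_surj[OF finite_atLeastLessThan image_subsetI calculation]) (rule par(2))
    ultimately show "bij_betw ?q ?U ?U" by (simp only: bij_betw_def)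
  qed simp
  have coeff_E: "Poly_Mapping.lookup (if (\<lambda>r. if r \<in> ?U - E then next_block s r else r) permutes ?U
       then (\<Prod>r\<in>E. a r) * (\<Prod>r\<in>?U - E. b r) else 0) (sqfree ?N) = (if E = E0 then 1 else 0)"
    if E: "E \<in> Pow ?U" for E
  proof (cases "(\<lambda>r. if r \<in> ?U - E then next_block s r else r) permutes ?U")
    case False
    then show ?thesis using permE0 by auto
  next
    case perm: True
    have EU: "E \<subseteq> ?U" using E by simp
    have fin: "finite E" using E finite_subset by auto
    note closed = next_block_closed[OF EU perm]
    consider "1 \<in> E" | "1 \<notin> E" "0 \<in> E" | "1 \<notin> E" "0 \<notin> E" by blast
    then show ?thesis
    proof cases
      case 1
      then have "(\<Prod>r\<in>E. a r) = 0" using fin by (intro prod_zero) (auto simp: a_def)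
      moreover have "E \<noteq> E0" using 1 by (auto simp: E0_def)
      ultimately show ?thesis by simp
    next
      case 2
      have "2 * t + 1 \<notin> E" if "t < s" for t using closed[of 0 t 1] 2 that s by auto
      moreover have "2 * t \<in> E" if "t < s" for t using closed[of t 0 0] 2 that s by auto
      ultimately have "r \<in> E \<longleftrightarrow> r \<in> E0" if "r \<in> ?U" for r
        using split_parity[OF that] that by (auto simp: E0_def)
      then have "E = E0" using EU by (auto simp: E0_def)
      then show ?thesis using perm prodE0 by simp
    next
      case 3
      have out: "2 * t + e \<notin> E" if "t < s" "e < 2" for t e
        using closed[of 0 t e] 3 that s less_2_cases[OF that(2)] by auto
      have "r \<notin> E" if "r \<in> ?U" for r
      proof -
        from split_parity[OF that] obtain t where "t < s" "r = 2 * t \<or> r = 2 * t + 1" by blast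
        then show ?thesis using out[of t 0] out[of t 1] by auto
      qed
      then have "E = {}" using EU by auto
      have "(\<Prod>r\<in>?U. b r) = (\<Prod>r\<in>E0. b r) * (\<Prod>r\<in>?U - E0. b r)"
        by (subst mult.commute, rule prod.subset_diff) (auto simp: E0_def)
      also have "(\<Prod>r\<in>E0. b r) = (\<Prod>t\<in>{0..<s}. Var (J ! t))"
        unfolding E0_image by (subst prod.reindex) (auto simp: inj_on_def b_def intro!: prod.cong)
      also have "(\<Prod>r\<in>?U - E0. b r) = (\<Prod>t\<in>{0..<s}. Var (J ! t))"
        unfolding odd_image by (subst prod.reindex) (auto simp: inj_on_def b_def intro!: prod.cong)
      finally have "(\<Prod>r\<in>?U. b r) = Poly_Mapping.single (sqfree (set J) + sqfree (set J)) 1"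
        using prod_nth[of J] s dist by (simp add: prod_Var_eq_sqfree mult_single)
      moreover have "sqfree (set J) + sqfree (set J) \<noteq> sqfree ?N"
      proof
        assume "sqfree (set J) + sqfree (set J) = sqfree ?N"
        then have "Poly_Mapping.lookup (sqfree (set J) + sqfree (set J)) ?p = Poly_Mapping.lookup (sqfree ?N) ?p" by simp
        moreover have "?p \<in> set I" using s hd by (auto intro: nth_mem)
        moreover from this have "?p \<notin> set J" using dist by auto
        ultimately show False by (simp add: lookup_add lookup_sqfree)
      qed
      moreover have "E0 \<noteq> {}" using s by (auto simp: E0_image)
      ultimately show ?thesis using \<open>E = {}\<close> by (simp add: lookup_single when_def)
    qed
  qed
  have "Poly_Mapping.lookup (?\<tau> (Determinant.det ?M)) (sqfree ?N) = (\<Sum>E\<in>Pow ?U. if E = E0 then 1 else 0)"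
    unfolding det lookup_sum by (intro sum.cong refl coeff_E)
  also have "\<dots> = 1" by (auto simp: sum.delta E0_def)
  finally show ?thesis .
qed

lemma keys_F_inv:
  fixes I J :: "'m list"
  shows "Poly_Mapping.keys (F_inv I J :: ('m \<times> 4, 'k::field) mpoly) =
   {\<mu> \<in> Poly_Mapping.keys (Determinant.det (cyclic_block_mat I J) :: ('m \<times> 4, 'k) mpoly).
     multidegree \<mu> = (\<lambda>i. if i \<in> set I \<union> set J then 1 else 0)}"
  by (rule Set.set_eqI) (simp add: F_inv_def in_keys_iff lookup_multihom_component when_def)

text \<open>The squarefree monomial on all indices of \<open>I\<close> and \<open>J\<close> only sees the component of multidegree one in each of them.\<close>
lemma scalar_restriction_F_inv:
  fixes I J :: "'m::finite list"
  shows "Poly_Mapping.lookup (scalar_restriction p (F_inv I J :: ('m \<times> 4, 'k::field) mpoly)) (sqfree (set I \<union> set J)) =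
   Poly_Mapping.lookup (scalar_restriction p (Determinant.det (cyclic_block_mat I J) :: ('m \<times> 4, 'k) mpoly))
     (sqfree (set I \<union> set J))"
  unfolding lookup_scalar_restriction keys_F_inv
  by (rule sum.cong) (simp_all add: F_inv_def lookup_multihom_component conj_ac)

lemma monom_degree_multidegree:
  fixes \<mu> :: "'m::finite \<times> 4 \<Rightarrow>\<^sub>0 nat"
  shows "monom_degree \<mu> = (\<Sum>i\<in>UNIV. multidegree \<mu> i)"
proof -
  have "monom_degree \<mu> = (\<Sum>v\<in>UNIV. Poly_Mapping.lookup \<mu> v)"
    unfolding monom_degree_def by (rule sum.mono_neutral_left) (auto simp: in_keys_iff)
  also have "\<dots> = (\<Sum>i\<in>UNIV. multidegree \<mu> i)"
    by (simp add: multidegree_def sum.cartesian_product UNIV_Times_UNIV)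
  finally show ?thesis .
qed

theorem proposition2p5:
  fixes I J :: "'m::finite list" and s :: nat
    and F :: "('m \<times> 4, 'k::alg_closed_field) mpoly"
  assumes "CHAR('k) = 2"
    and "s \<ge> 1" and "length I = s" and "length J = s"
    and "distinct (I @ J)"
    and "F = F_inv I J"
  shows "F \<in> invariants SO4 \<and>
    \<not> polynomial_in {f \<in> invariants SO4. total_degree f < total_degree F} F"
proof
  show "F \<in> invariants SO4" unfolding assms(6) by (rule F_inv_invariant[OF assms(1)])
  define p where "p = hd I"
  define N where "N = set I \<union> set J"
  have "p \<in> N" using assms by (auto simp: p_def N_def intro!: hd_in_set)
  \<comment> \<open>A subalgebra that contains the restrictions of all invariants of low degree, but not that of \<open>F\<close>.\<close>
  define D where "D = (top_free p N :: ('m, 'k) mpoly set)"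
  have D_Const: "Const c \<in> D" for c
    unfolding D_def using \<open>p \<in> N\<close> by (intro top_free_Const) auto
  have D_add: "f + g \<in> D" if "f \<in> D" "g \<in> D" for f g
    using that unfolding D_def by (rule top_free_add)
  have D_mult: "f * g \<in> D" if "f \<in> D" "g \<in> D" for f g
    using \<open>p \<in> N\<close> that unfolding D_def by (rule top_free_mult)
  interpret T: comm_ring_hom "scalar_restriction p :: ('m \<times> 4, 'k) mpoly \<Rightarrow> _"
    unfolding scalar_restriction_def by (rule poly_subst_hom)
  have one: "1 \<in> D" using D_Const[of 1] by (simp add: Const_def)
  have D_power: "f ^ n \<in> D" if "f \<in> D" for f n
    by (induction n) (simp_all add: one D_mult that)
  have D_prod: "prod h X \<in> D" if "\<And>x. x \<in> X \<Longrightarrow> h x \<in> D" for h and X :: "nat set"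
    using that by (induction X rule: infinite_finite_induct) (simp_all add: one D_mult)
  have D_sum: "sum h X \<in> D" if "\<And>x. x \<in> X \<Longrightarrow> h x \<in> D" for h and X :: "(nat \<Rightarrow>\<^sub>0 nat) set"
    using that D_Const[of 0]
    by (induction X rule: infinite_finite_induct) (simp_all add: Const_def D_add)
  have degree_F: "total_degree F \<le> card N"
  proof -
    have "monom_degree \<mu> = card N" if "\<mu> \<in> Poly_Mapping.keys F" for \<mu>
    proof -
      have "multidegree \<mu> = (\<lambda>i. if i \<in> N then 1 else 0)"
        using that unfolding assms(6) keys_F_inv N_def by blast
      then show ?thesis by (simp add: monom_degree_multidegree sum.If_cases)
    qed
    then show ?thesis by (auto simp: total_degree_def)
  qed
  \<comment> \<open>Monomials that restrict to \<open>t\<^sub>N\<close> have degree \<open>card N\<close>, which is too large for \<open>f\<close>.\<close>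
  have D_low: "scalar_restriction p f \<in> D"
    if f: "f \<in> invariants SO4" and deg: "total_degree f < total_degree F" for f :: "('m \<times> 4, 'k) mpoly"
  proof -
    have "lin_act swap_mat f = f"
      using f swap_in_SO4[OF assms(1)] unfolding invariants_def by blast
    then have "Poly_Mapping.lookup (scalar_restriction p f) (sqfree B) = 0" if "B \<noteq> {}" "p \<notin> B" for B
      using scalar_restriction_swap_invariant[OF assms(1) _ that] by blast
    moreover have "Poly_Mapping.lookup (scalar_restriction p f) (sqfree N) = 0"
    proof -
      have "multidegree \<mu> \<noteq> (\<lambda>i. if i \<in> N then 1 else 0)" if "\<mu> \<in> Poly_Mapping.keys f" for \<mu>
      proof
        assume "multidegree \<mu> = (\<lambda>i. if i \<in> N then 1 else 0)"
        then have "monom_degree \<mu> = card N" by (simp add: monom_degree_multidegree sum.If_cases)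
        moreover have "monom_degree \<mu> \<le> total_degree f"
          unfolding total_degree_def using that by (intro Max_ge) auto
        ultimately show False using deg degree_F by simp
      qed
      then show ?thesis unfolding lookup_scalar_restriction by (intro sum.neutral) auto
    qed
    ultimately show ?thesis by (simp add: D_def top_free_def)
  qed
  have "Poly_Mapping.lookup (scalar_restriction p F) (sqfree N) = 1"
    unfolding assms(6) N_def scalar_restriction_F_inv p_def by (rule scalar_restriction_det[OF assms(1-5)])
  then have "scalar_restriction p F \<notin> D" by (simp add: D_def top_free_def)
  moreover have "scalar_restriction p F \<in> D"
    if "polynomial_in {f \<in> invariants SO4. total_degree f < total_degree F} F"
  proof -
    from that obtain n g and P :: "(nat, 'k) mpoly"
      where g: "\<And>l. l < n \<Longrightarrow> g l \<in> {f \<in> invariants SO4. total_degree f < total_degree F}"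
        and P: "indets P \<subseteq> {..<n}" and F: "F = poly_subst g P"
      unfolding polynomial_in_def by blast
    have const: "scalar_restriction p (Const c) = Const c" for c :: 'k
      by (simp add: scalar_restriction_def poly_subst_Const)
    have g_Dec: "scalar_restriction p (g l) \<in> D"
      if "\<mu> \<in> Poly_Mapping.keys P" "l \<in> Poly_Mapping.keys \<mu>" for \<mu> l
    proof -
      have "l < n" using that P by (auto simp: indets_def)
      then show ?thesis using g D_low by blast
    qed
    have "scalar_restriction p F = (\<Sum>\<mu>\<in>Poly_Mapping.keys P. Const (Poly_Mapping.lookup P \<mu>) *
        (\<Prod>l\<in>Poly_Mapping.keys \<mu>. scalar_restriction p (g l) ^ Poly_Mapping.lookup \<mu> l))"
      by (simp add: F poly_subst_def insertion_def T.hom_sum T.hom_mult T.hom_prod T.hom_power const)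
    also have "\<dots> \<in> D"
      by (intro D_sum D_mult D_Const D_prod D_power g_Dec)
    finally show ?thesis .
  qed
  ultimately show "\<not> polynomial_in {f \<in> invariants SO4. total_degree f < total_degree F} F" by blast
qed

end
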